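(* (Hopf–Hopf mode interaction.) Let $c,d,\phi_{3,01},\phi_{2,10}$ be real constants with $\phi_{3,01}\neq0$, $\phi_{2,10}\ne0$ and $\Delta_2\equiv\frac18\phi_{2,10}\phi_{3,01}-cd\neq0$, and consider, for $(\alpha_2,\alpha_3)$ near $(0,0)$, the amplitude equations $$\dot r=r\,[\alpha_3+c\rho^2+\phi_{3,01}r^2+\cdots],\qquad \dot\rho=\rho\,[\tfrac12\alpha_2+\tfrac18\phi_{2,10}\rho^2+d\,r^2+\cdots].$$ Then there are four families of solutions with $(\dot r,\dot\rho)=(0,0)$ near the origin in $r,\rho\ge0$, given to leading order by $$(r,\rho)=(0,0),\qquad (r,\rho)=\Bigl(\sqrt{-\tfrac{\alpha_3}{\phi_{3,01}}},\,0\Bigr),\qquad (r,\rho)=\Bigl(0,\,\sqrt{-\tfrac{4\alpha_2}{\phi_{2,10}}}\Bigr),$$ $$(r,\rho)=\left(\sqrt{\frac{\frac12\alpha_2c-\frac18\alpha_3\phi_{2,10}}{\Delta_2}},\ \sqrt{\frac{\alpha_3d-\frac12\alpha_2\phi_{3,01}}{\Delta_2}}\right),$$ each existing when the quantities under its square roots (in their exact form) are positive. For the corresponding four-dimensional amplitude–phase flow, the second and third families are periodic orbits and the fourth family consists of two-frequency solutions on an invariant $2$-torus. To leading order, the $2$-torus bifurcates from the second (periodic) family when $$\alpha_3d=\tfrac12\alpha_2\phi_{3,01},\qquad \rho=0,\qquad r=\sqrt{-\frac{\alpha_3}{\phi_{3,01}}},$$ and from the third (periodic) family when $$\alpha_2c=\tfrac14\alpha_3\phi_{2,10},\qquad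 \rho=\sqrt{-\frac{4\alpha_2}{\phi_{2,10}}},\qquad r=0.$$
   Context: The amplitude equations are the decoupled amplitude part of a four-dimensional nonresonant Hopf–Hopf normal form with polar variables $(r,\theta)$, $(\rho,\varphi)$: the right-hand sides in $\dot r,\dot\rho,\dot\theta,\dot\varphi$ do not depend on $\theta,\varphi$, and $\dot\theta\to1$, $\dot\varphi\to\omega_0$ at the origin for $(\alpha_2,\alpha_3)=(0,0)$, where $\omega_0>0$ is a (small) fixed frequency (in the source, $\omega_0=\sqrt{-\alpha_1}$ for a fixed $\alpha_1<0$). The brackets are $C^\infty$ functions of $(r^2,\rho^2,\alpha_2,\alpha_3)$, and $\cdots$ denotes terms of order at least two in these four quantities, where $r^2,\rho^2,\alpha_2,\alpha_3$ each count as order one. "To leading order" means that the exact values of $r^2,\rho^2$ differ from the displayed ones by terms of order at least two in $(\alpha_2,\alpha_3)$, and that the bifurcation curves in the $(\alpha_2,\alpha_3)$-plane are tangent at the origin to the displayed lines. A point with $r>0,\rho=0$ (respectively $r=0,\rho>0$) with $\dot r=\dot\rho=0$ corresponds to a periodic orbit of the four-dimensional flow, and a point with $r>0,\rho>0$ to an invariant $2$-torus. *)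

theory Defs
  imports "HOL-Analysis.Analysis" "HOL-Library.Landau_Symbols"
begin

section \<open>Smooth functions\<close>

text \<open>Meant for open \<open>S\<close>: all iterated directional derivatives up to order \<open>n\<close> exist
  (as values of total derivatives) and are continuous.\<close>

primrec Ck_on :: "nat \<Rightarrow> 'a::euclidean_space set \<Rightarrow> ('a \<Rightarrow> 'b::real_normed_vector) \<Rightarrow> bool" where
  "Ck_on 0 S f \<longleftrightarrow> continuous_on S f"
| "Ck_on (Suc n) S f \<longleftrightarrow>
     (\<forall>x\<in>S. f differentiable (at x)) \<and>
     (\<forall>v. Ck_on n S (\<lambda>x. frechet_derivative f (at x) v))"

definition smooth_on :: "'a::euclidean_space set \<Rightarrow> ('a \<Rightarrow> 'b::real_normed_vector) \<Rightarrow> bool" where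
  "smooth_on S f \<longleftrightarrow> (\<forall>n. Ck_on n S f)"


section \<open>The amplitude equations\<close>

text \<open>Brackets are functions of the four quantities \<open>(r\<^sup>2, \<rho>\<^sup>2, \<alpha>\<^sub>2, \<alpha>\<^sub>3)\<close>;
  parameters are pairs \<open>(\<alpha>\<^sub>2, \<alpha>\<^sub>3)\<close>, amplitudes are pairs \<open>(r, \<rho>)\<close>.\<close>

type_synonym four_real_function = "real \<times> real \<times> real \<times> real \<Rightarrow> real"

fun amplitude_field ::
  "four_real_function \<Rightarrow> four_real_function \<Rightarrow> real \<times> real \<Rightarrow> real \<times> real \<Rightarrow> real \<times> real" where
  "amplitude_field F G (\<alpha>2, \<alpha>3) (r, \<rho>) =
     (r * F (r\<^sup>2, \<rho>\<^sup>2, \<alpha>2, \<alpha>3), \<rho> * G (r\<^sup>2, \<rho>\<^sup>2, \<alpha>2, \<alpha>3))"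


section \<open>The four-dimensional amplitude-phase flow\<close>

text \<open>The flow of \<open>r' = r F\<close>, \<open>\<theta>' = \<Theta>\<close>, \<open>\<rho>' = \<rho> G\<close>, \<open>\<phi>' = \<Phi>\<close>, written in the coordinates
  \<open>z = r cis \<theta>\<close>, \<open>w = \<rho> cis \<phi>\<close>, in which it is also defined where an amplitude vanishes
  (see \<open>polar_solution\<close> below). The phase speeds are functions of \<open>(r, \<rho>, \<alpha>\<^sub>2, \<alpha>\<^sub>3)\<close>,
  with \<open>r\<close> and \<open>\<rho>\<close> not squared.\<close>

fun flow_field ::
  "four_real_function \<Rightarrow> four_real_function \<Rightarrow> four_real_function \<Rightarrow> four_real_function \<Rightarrow>
   real \<times> real \<Rightarrow> complex \<times> complex \<Rightarrow> complex \<times> complex" where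
  "flow_field F G \<Theta> \<Phi> (\<alpha>2, \<alpha>3) (z, w) =
     (z * Complex (F ((cmod z)\<^sup>2, (cmod w)\<^sup>2, \<alpha>2, \<alpha>3)) (\<Theta> (cmod z, cmod w, \<alpha>2, \<alpha>3)),
      w * Complex (G ((cmod z)\<^sup>2, (cmod w)\<^sup>2, \<alpha>2, \<alpha>3)) (\<Phi> (cmod z, cmod w, \<alpha>2, \<alpha>3)))"

definition flow_domain ::
  "(real \<times> real \<times> real \<times> real) set \<Rightarrow> real \<times> real \<Rightarrow> (complex \<times> complex) set" where
  "flow_domain W \<alpha> = {(z, w). ((cmod z)\<^sup>2, (cmod w)\<^sup>2, fst \<alpha>, snd \<alpha>) \<in> W}"

definition is_solution ::
  "('a::real_normed_vector \<Rightarrow> 'a) \<Rightarrow> 'a set \<Rightarrow> real set \<Rightarrow> (real \<Rightarrow> 'a) \<Rightarrow> bool" where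
  "is_solution X D I x \<longleftrightarrow>
     (\<forall>t\<in>I. x t \<in> D \<and> (x has_vector_derivative X (x t)) (at t within I))"

lemma polar_solution:
  fixes r \<theta> \<rho> \<phi> :: "real \<Rightarrow> real"
  assumes "\<And>t. t \<in> I \<Longrightarrow> 0 \<le> r t \<and> 0 \<le> \<rho> t \<and> ((r t)\<^sup>2, (\<rho> t)\<^sup>2, \<alpha>2, \<alpha>3) \<in> W"
    and "\<And>t. t \<in> I \<Longrightarrow>
      (r has_real_derivative r t * F ((r t)\<^sup>2, (\<rho> t)\<^sup>2, \<alpha>2, \<alpha>3)) (at t within I)"
    and "\<And>t. t \<in> I \<Longrightarrow>
      (\<rho> has_real_derivative \<rho> t * G ((r t)\<^sup>2, (\<rho> t)\<^sup>2, \<alpha>2, \<alpha>3)) (at t within I)"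
    and "\<And>t. t \<in> I \<Longrightarrow> (\<theta> has_real_derivative \<Theta> (r t, \<rho> t, \<alpha>2, \<alpha>3)) (at t within I)"
    and "\<And>t. t \<in> I \<Longrightarrow> (\<phi> has_real_derivative \<Phi> (r t, \<rho> t, \<alpha>2, \<alpha>3)) (at t within I)"
  shows "is_solution (flow_field F G \<Theta> \<Phi> (\<alpha>2, \<alpha>3)) (flow_domain W (\<alpha>2, \<alpha>3)) I
    (\<lambda>t. (r t * cis (\<theta> t), \<rho> t * cis (\<phi> t)))"
proof -
  have polar: "((\<lambda>t. of_real (s t) * cis (\<psi> t)) has_vector_derivative
      (of_real (s t) * cis (\<psi> t)) * Complex a b) (at t within I)"
    if "(s has_real_derivative s t * a) (at t within I)"
      and "(\<psi> has_real_derivative b) (at t within I)"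
    for s \<psi> :: "real \<Rightarrow> real" and a b t
  proof -
    have "((\<lambda>t. s t * cos (\<psi> t)) has_real_derivative
        s t * a * cos (\<psi> t) - s t * (sin (\<psi> t) * b)) (at t within I)"
      and "((\<lambda>t. s t * sin (\<psi> t)) has_real_derivative
        s t * a * sin (\<psi> t) + s t * (cos (\<psi> t) * b)) (at t within I)"
      using that by (auto intro!: derivative_eq_intros)
    then show ?thesis
      by (simp add: has_vector_derivative_complex_iff algebra_simps)
  qed
  show ?thesis
    using assms polar
    by (auto simp: is_solution_def flow_domain_def norm_mult intro!: has_vector_derivative_Pair)
qed

definition periodic_orbit ::
  "('a::real_normed_vector \<Rightarrow> 'a) \<Rightarrow> 'a set \<Rightarrow> 'a set \<Rightarrow> bool" where
  "periodic_orbit X D M \<longleftrightarrow>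
     (\<exists>x T. is_solution X D UNIV x \<and> 0 < T \<and> (\<forall>t. x (t + T) = x t) \<and>
        \<not> x constant_on UNIV \<and> M = range x)"

definition invariant_under ::
  "('a::real_normed_vector \<Rightarrow> 'a) \<Rightarrow> 'a set \<Rightarrow> 'a set \<Rightarrow> bool" where
  "invariant_under X D M \<longleftrightarrow>
     (\<forall>I x. is_interval I \<and> 0 \<in> I \<and> is_solution X D I x \<and> x 0 \<in> M \<longrightarrow> (\<forall>t\<in>I. x t \<in> M))"

text \<open>A homeomorphism \<open>h\<close> from the standard torus conjugates the flow on \<open>M\<close> to a rotation with
  two nonzero frequencies; no other solutions start on \<open>M\<close>. The two frequencies may be
  rationally dependent.\<close>

definition two_frequency_torus ::
  "('a::real_normed_vector \<Rightarrow> 'a) \<Rightarrow> 'a set \<Rightarrow> 'a set \<Rightarrow> bool" where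
  "two_frequency_torus X D M \<longleftrightarrow>
     invariant_under X D M \<and>
     (\<exists>h k \<omega>1 \<omega>2. homeomorphism (sphere (0::complex) 1 \<times> sphere (0::complex) 1) M h k \<and>
        \<omega>1 \<noteq> 0 \<and> \<omega>2 \<noteq> 0 \<and>
        (\<forall>u\<in>sphere 0 1. \<forall>v\<in>sphere 0 1.
           is_solution X D UNIV (\<lambda>t. h (u * cis (\<omega>1 * t), v * cis (\<omega>2 * t)))) \<and>
        (\<forall>I x. is_interval I \<and> 0 \<in> I \<and> is_solution X D I x \<and> x 0 \<in> M \<longrightarrow>
           (\<exists>u\<in>sphere 0 1. \<exists>v\<in>sphere 0 1.
              \<forall>t\<in>I. x t = h (u * cis (\<omega>1 * t), v * cis (\<omega>2 * t)))))"


section \<open>Bifurcation of one family of equilibria from another\<close>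

text \<open>A family is given by the set of parameters for which it exists and its position there.
  At the parameter \<open>a\<close> the family \<open>(E', p')\<close> branches off \<open>(E, p)\<close>: the latter persists near
  \<open>a\<close>, the former merges with it as the parameter tends to \<open>a\<close>, and ceases to exist across \<open>a\<close>.\<close>

definition bifurcates_from ::
  "'a::metric_space set \<Rightarrow> ('a \<Rightarrow> 'b::metric_space) \<Rightarrow> 'a set \<Rightarrow> ('a \<Rightarrow> 'b) \<Rightarrow> 'a \<Rightarrow> bool" where
  "bifurcates_from E' p' E p a \<longleftrightarrow>
     a \<in> interior E \<and> a \<notin> E' \<and> a \<in> closure E' \<and> a \<in> closure (interior (- E')) \<and>
     (p' \<longlongrightarrow> p a) (at a within E')"

text \<open>Inside \<open>V\<close>, the set \<open>B\<close> is the branch \<open>s > 0\<close> of a \<open>C\<^sup>1\<close> curve \<open>g\<close> through the origin whose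
  tangent vector there is nonzero and lies on the ray \<open>L\<close>.\<close>

definition curve_tangent_to_ray ::
  "'a::real_normed_vector set \<Rightarrow> 'a set \<Rightarrow> 'a set \<Rightarrow> bool" where
  "curve_tangent_to_ray V B L \<longleftrightarrow>
     (\<exists>g v \<epsilon>. 0 < \<epsilon> \<and> g C1_differentiable_on {- \<epsilon> <..< \<epsilon>} \<and> g 0 = 0 \<and>
        (g has_vector_derivative v) (at 0) \<and> v \<noteq> 0 \<and> v \<in> L \<and>
        B = V \<inter> g ` {0 <..< \<epsilon>})"

end

theory Submission
  imports Defs
begin

text \<open>In the unknowns \<open>R = r\<^sup>2\<close>, \<open>S = \<rho>\<^sup>2\<close> the equilibrium conditions are smooth equations whose
  linear parts can be solved for \<open>R\<close> (on \<open>S = 0\<close>), for \<open>S\<close> (on \<open>R = 0\<close>), and for \<open>(R, S)\<close>, because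
  \<open>\<phi>301\<close>, \<open>\<phi>210\<close> and \<open>\<Delta>2\<close> do not vanish; the implicit function theorem gives the three nontrivial
  families. The equations \<open>F = G = 0\<close> can also be solved for the parameters, \<open>\<alpha> = \<gamma>(R, S)\<close>, so that
  \<open>\<gamma>\<close> is a local inverse of \<open>\<alpha> \<mapsto> (P \<alpha>, Q \<alpha>)\<close>. The bifurcation curves are therefore the images of the
  half-axes under \<open>\<gamma>\<close>, and moving \<open>(R, S)\<close> across a half-axis shows that the torus appears or
  disappears there. The phase speeds are not assumed continuous, so uniqueness of solutions on the
  torus is obtained in two steps: the squared moduli solve an autonomous planar equation that rests
  at an equilibrium, and with constant moduli the phase equations are linear.\<close>

section \<open>Implicit functions with quadratic error\<close>

text \<open>The derivative of a local inverse is obtained as a pointwise inverse, and this gives its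
  continuity. With \<open>L\<close> bounded below by \<open>B\<close>, every \<open>A x\<close>
  within \<open>B / 2\<close> of \<open>L\<close> is bounded below by \<open>B / 2\<close>. Applied
  to the difference of the two preimages of \<open>v\<close>, this bounds it by a multiple of
  \<open>v - A x w\<close>, which tends to \<open>v - L w = 0\<close>.\<close>

lemma tendsto_inv_blinfun:
  fixes A :: "'c \<Rightarrow> 'a::euclidean_space \<Rightarrow>\<^sub>L 'a"
  assumes A: "(A \<longlongrightarrow> L) F"
    and bij: "bij (blinfun_apply L)" "\<forall>\<^sub>F x in F. bij (blinfun_apply (A x))"
  shows "((\<lambda>x. inv (blinfun_apply (A x)) v) \<longlongrightarrow> inv (blinfun_apply L) v) F"
proof -
  define w where "w = inv (blinfun_apply L) v"
  have Lw: "L w = v"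
    using bij(1) by (simp add: w_def bij_is_surj surj_f_inv_f)
  obtain B where "B > 0" and B: "\<And>u. B * norm u \<le> norm (L u)"
    using linear_inj_bounded_below_pos[of "blinfun_apply L"] bij(1)
    by (metis bij_is_inj blinfun.bounded_linear_right bounded_linear.linear)
  have "\<forall>\<^sub>F x in F. dist (A x) L < B / 2"
    by (intro tendstoD[OF A]) (simp add: \<open>B > 0\<close>)
  then have ev: "\<forall>\<^sub>F x in F. norm (inv (blinfun_apply (A x)) v - w) \<le> 2 / B * norm (v - A x w)"
    using bij(2)
  proof eventually_elim
    fix x
    assume "dist (A x) L < B / 2" and bijx: "bij (blinfun_apply (A x))"
    then have d: "norm (A x - L) \<le> B / 2"
      by (simp add: dist_norm)
    let ?u = "inv (blinfun_apply (A x)) v - w"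
    have "A x ?u = v - A x w"
      using bijx by (simp add: blinfun.diff_right bij_is_surj surj_f_inv_f)
    moreover have "norm ((A x - L) ?u) \<le> B / 2 * norm ?u"
      by (meson d mult_right_mono norm_blinfun norm_ge_zero order_trans)
    moreover have "norm (L ?u) \<le> norm (A x ?u) + norm ((A x - L) ?u)"
      by (metis blinfun.diff_left norm_minus_commute norm_triangle_sub)
    ultimately have "B / 2 * norm ?u \<le> norm (v - A x w)"
      using B[of ?u] by simp
    then show "norm ?u \<le> 2 / B * norm (v - A x w)"
      using \<open>B > 0\<close> by (simp add: field_simps)
  qed
  have "((\<lambda>x. 2 / B * norm (v - A x w)) \<longlongrightarrow> 2 / B * norm (v - L w)) F"
    by (intro tendsto_intros A)
  then have "((\<lambda>x. 2 / B * norm (v - A x w)) \<longlongrightarrow> 0) F"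
    by (simp add: Lw)
  then have "((\<lambda>x. inv (blinfun_apply (A x)) v - w) \<longlongrightarrow> 0) F"
    by (rule Lim_null_comparison[OF ev])
  then show ?thesis
    by (simp add: w_def LIM_zero_iff)
qed

text \<open>The inverse function theorem is applied to \<open>e (x, y) = (f (x, y), y)\<close>; the
  implicit function is the first component of its local inverse on the slice \<open>(0, y)\<close>.
  Continuity of the derivative is stated direction by direction, which in finite dimension amounts
  to continuity in operator norm.\<close>

lemma implicit_function_theorem:
  fixes f :: "'a::euclidean_space \<times> 'b::euclidean_space \<Rightarrow> 'a"
  assumes W: "open W" "0 \<in> W" and f0: "f 0 = 0"
    and der: "\<And>x. x \<in> W \<Longrightarrow> (f has_derivative f' x) (at x)"
    and cont: "\<And>v. continuous_on W (\<lambda>x. f' x v)"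
    and inj: "\<And>u. f' 0 (u, 0) = 0 \<Longrightarrow> u = 0"
  obtains X Y h h' where "open X" "0 \<in> X" "open Y" "0 \<in> Y" "X \<times> Y \<subseteq> W" "h 0 = 0"
    "\<And>y. y \<in> Y \<Longrightarrow> h y \<in> X"
    "\<And>x y. x \<in> X \<Longrightarrow> y \<in> Y \<Longrightarrow> f (x, y) = 0 \<longleftrightarrow> x = h y"
    "\<And>y. y \<in> Y \<Longrightarrow> (h has_derivative h' y) (at y)"
    "\<And>v. continuous_on Y (\<lambda>y. h' y v)"
proof -
  define e where "e = (\<lambda>p. (f p, snd p))"
  define e' where "e' x = Blinfun (\<lambda>v. (f' x v, snd v))" for x
  have bl: "bounded_linear (f' x)" if "x \<in> W" for x
    using der[OF that] by (rule has_derivative_bounded_linear)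
  have e'_apply: "blinfun_apply (e' x) = (\<lambda>v. (f' x v, snd v))" if "x \<in> W" for x
    unfolding e'_def using bl[OF that]
    by (intro bounded_linear_Blinfun_apply bounded_linear_Pair bounded_linear_snd)
  have der_e: "(e has_derivative blinfun_apply (e' x)) (at x)" if "x \<in> W" for x
    unfolding e'_apply[OF that] e_def using der[OF that]
    by (auto intro!: derivative_eq_intros)
  have "continuous_on W (\<lambda>x. blinfun_apply (e' x) v)" for v
    using continuous_on_Pair[OF cont[of v] continuous_on_const[of W "snd v"]]
    by (subst continuous_on_cong[OF refl]) (auto simp: e'_apply)
  then have cont_e: "continuous_on W e'"
    by (rule continuous_on_blinfun_componentwise)
  \<comment> \<open>The second component of \<open>e' 0\<close> is the identity in the parameter, so
    a kernel vector has the form \<open>(u, 0)\<close> and \<open>inj\<close> applies.\<close>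
  have "inj (blinfun_apply (e' 0))"
  proof (subst linear_injective_0)
    show "linear (blinfun_apply (e' 0))"
      by (intro bounded_linear.linear blinfun.bounded_linear_right)
    show "\<forall>x. blinfun_apply (e' 0) x = 0 \<longrightarrow> x = 0"
      using inj by (auto simp: e'_apply[OF W(2)] prod_eq_iff)
  qed
  then obtain k where "linear k" and k: "k \<circ> blinfun_apply (e' 0) = id"
    using linear_injective_left_inverse[OF bounded_linear.linear[OF blinfun.bounded_linear_right]] by blast
  then have "Blinfun k o\<^sub>L e' 0 = id_blinfun"
    by (intro blinfun_eqI)
      (simp add: bounded_linear_Blinfun_apply linear_conv_bounded_linear pointfree_idE)
  from inverse_function_theorem[OF W(1) der_e cont_e W(2) this]
  obtain U' V g g' where U': "open U'" "U' \<subseteq> W" "0 \<in> U'" and V: "open V" "e 0 \<in> V"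
    and hom: "homeomorphism U' V e g"
    and der_g: "\<And>y. y \<in> V \<Longrightarrow> (g has_derivative g' y) (at y)"
    and g': "\<And>y. y \<in> V \<Longrightarrow> g' y = inv (blinfun_apply (e' (g y)))"
    and bij: "\<And>y. y \<in> V \<Longrightarrow> bij (blinfun_apply (e' (g y)))"
    by metis
  have e0: "e 0 = 0"
    using f0 by (simp add: e_def zero_prod_def)
  have gU: "g y \<in> U'" and eg: "e (g y) = y" if "y \<in> V" for y
    using hom that by (auto simp: homeomorphism_def)
  have ge: "g (e x) = x" and eV: "e x \<in> V" if "x \<in> U'" for x
    using hom that by (auto simp: homeomorphism_def)
  have cg: "continuous_on V g"
    using hom by (simp add: homeomorphism_def)
  obtain X Y0 where XY: "open X" "open Y0" "0 \<in> X \<times> Y0" "X \<times> Y0 \<subseteq> U'"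
    using open_prod_elim[OF U'(1,3)] by metis
  define h where "h y = fst (g (0, y))" for y
  \<comment> \<open>\<open>Y0\<close> keeps \<open>X \<times> Y\<close> inside \<open>U'\<close>,
    where \<open>e\<close> is injective, which yields uniqueness of the root; \<open>V\<close> makes
    \<open>g (0, y)\<close> meaningful. The further intersection with the preimage of
    \<open>X\<close> ensures that \<open>h\<close> takes values in \<open>X\<close>.\<close>
  define Y1 where "Y1 = Pair 0 -` V \<inter> Y0"
  define Y where "Y = Y1 \<inter> h -` X"
  have oY1: "open Y1"
    unfolding Y1_def by (intro open_Int XY open_vimage V continuous_intros)
  have "continuous_on Y1 h"
    unfolding h_def
    by (intro continuous_intros continuous_on_compose2[OF cg]) (auto simp: Y1_def)
  then have oY: "open Y"
    unfolding Y_def by (metis continuous_open_preimage Int_commute oY1 XY(1))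
  have h0: "h 0 = 0"
    using ge[OF U'(3)] by (simp add: h_def e0 flip: zero_prod_def)
  have YV: "(0, y) \<in> V" "y \<in> Y0" "h y \<in> X" if "y \<in> Y" for y
    using that by (auto simp: Y_def Y1_def)
  have gh: "g (0, y) = (h y, y)" if "y \<in> Y" for y
    using eg[OF YV(1)[OF that]] by (auto simp: e_def h_def prod_eq_iff)
  define h' where "h' y v = fst (g' (0, y) (0, v))" for y v
  show thesis
  proof (rule that)
    show "open X" "open Y" "0 \<in> X" "h 0 = 0"
      using XY oY h0 by (auto simp: zero_prod_def)
    show "0 \<in> Y"
      using XY V e0 h0 by (auto simp: Y_def Y1_def zero_prod_def)
    show "X \<times> Y \<subseteq> W"
      using XY(4) U'(2) YV(2) by blast
    show "h y \<in> X" if "y \<in> Y" for y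
      using YV that by auto
    show "f (x, y) = 0 \<longleftrightarrow> x = h y" if "x \<in> X" "y \<in> Y" for x y
    proof
      assume "f (x, y) = 0"
      then have "e (x, y) = (0, y)" by (simp add: e_def)
      moreover have "(x, y) \<in> U'" using XY(4) that YV by auto
      ultimately have "g (0, y) = (x, y)" using ge by metis
      then show "x = h y" by (simp add: h_def)
    next
      assume "x = h y"
      then show "f (x, y) = 0"
        using eg[OF YV(1)[OF that(2)]] gh[OF that(2)] by (simp add: e_def)
    qed
    show "(h has_derivative h' y) (at y)" if "y \<in> Y" for y
    proof -
      have "((\<lambda>y. (0, y)) has_derivative (\<lambda>v. (0, v))) (at y)"
        by (auto intro!: derivative_eq_intros)
      from has_derivative_fst[OF has_derivative_compose[OF this der_g[OF YV(1)[OF that]]]]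
      show ?thesis by (simp add: h_def[abs_def] h'_def[abs_def])
    qed
    show "continuous_on Y (\<lambda>y. h' y v)" for v
    proof -
      have "continuous_on V (\<lambda>y. g' y w)" for w
        unfolding continuous_on_def
      proof
        fix y assume y: "y \<in> V"
        have "continuous_on V (\<lambda>y. e' (g y))"
          by (rule continuous_on_compose2[OF cont_e cg]) (use gU U' in auto)
        then have "((\<lambda>y. e' (g y)) \<longlongrightarrow> e' (g y)) (at y within V)"
          using y by (simp add: continuous_on_def)
        moreover have ev: "\<forall>\<^sub>F z in at y within V. z \<in> V"
          by (simp add: eventually_at_filter)
        ultimately have "((\<lambda>y. inv (blinfun_apply (e' (g y))) w) \<longlongrightarrow> inv (blinfun_apply (e' (g y))) w)
            (at y within V)"
          by (intro tendsto_inv_blinfun bij y) (auto elim: eventually_mono intro: bij)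
        then show "((\<lambda>y. g' y w) \<longlongrightarrow> g' y w) (at y within V)"
          unfolding g'[OF y]
          by (rule Lim_transform_eventually) (use ev in eventually_elim, simp add: g')
      qed
      moreover have "continuous_on Y (\<lambda>y. (0, y))"
        by (intro continuous_intros)
      ultimately have "continuous_on Y (\<lambda>y. g' (0, y) (0, v))"
        by (rule continuous_on_compose2) (auto simp: YV)
      then show ?thesis
        unfolding h'_def by (rule continuous_on_fst)
    qed
  qed
qed

text \<open>A quadratic error divided by \<open>norm x\<close> is at most \<open>C * norm x\<close>.
  The bound is assumed on a full neighbourhood, 0 included, and therefore also forces
  \<open>f 0 = 0\<close>.\<close>

lemma has_derivative_quadratic_remainder:
  fixes f :: "'a::real_normed_vector \<Rightarrow> 'b::real_normed_vector"
  assumes L: "bounded_linear L" and C: "\<forall>\<^sub>F x in nhds 0. norm (f x - L x) \<le> C * (norm x)\<^sup>2"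
  shows "f 0 = 0" "(f has_derivative L) (at 0)"
proof -
  show f0: "f 0 = 0"
    using eventually_nhds_x_imp_x[OF C] by (simp add: L linear_simps)
  show "(f has_derivative L) (at 0)"
    unfolding has_derivative_at
  proof (intro conjI L)
    have C': "\<forall>\<^sub>F x in at 0. norm (norm (f (0 + x) - f 0 - L x) / norm x) \<le> C * norm x"
      using eventually_nhds_conv_at[THEN iffD1, THEN conjunct1, OF C]
      by eventually_elim (auto simp: f0 divide_simps power2_eq_square)
    have "((\<lambda>x. C * norm x) \<longlongrightarrow> C * norm (0::'a)) (at (0::'a))"
      by (rule tendsto_mult[OF tendsto_const tendsto_norm[OF tendsto_ident_at]])
    then show "(\<lambda>x. norm (f (0 + x) - f 0 - L x) / norm x) \<midarrow>0\<rightarrow> 0"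
      by (intro Lim_null_comparison[OF C']) simp
  qed
qed

text \<open>A one-point substitute for a Lipschitz condition: the slope is the operator bound
  \<open>M\<close> of the derivative plus 1 for the remainder.\<close>

lemma differentiable_zero_linear_bound:
  fixes X :: "'a::real_normed_vector \<Rightarrow> 'b::real_normed_vector"
  assumes "X differentiable (at p)" "X p = 0"
  obtains K where "\<forall>\<^sub>F x in nhds p. norm (X x) \<le> K * norm (x - p)"
proof -
  obtain L where L: "(X has_derivative L) (at p)"
    using assms(1) by (auto simp: differentiable_def)
  obtain M where M: "\<And>v. norm (L v) \<le> norm v * M"
    using bounded_linear.bounded[OF has_derivative_bounded_linear[OF L]] by blast
  have "\<forall>\<^sub>F x in at p. norm (X x - X p - L (x - p)) / norm (x - p) < 1"
    using L unfolding has_derivative_iff_norm by (intro order_tendstoD(2)[of _ 0]) auto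
  then have "\<forall>\<^sub>F x in nhds p. x \<noteq> p \<longrightarrow> norm (X x - L (x - p)) / norm (x - p) < 1"
    by (simp add: eventually_at_filter assms(2))
  then have "\<forall>\<^sub>F x in nhds p. norm (X x) \<le> (M + 1) * norm (x - p)"
  proof eventually_elim
    fix x assume *: "x \<noteq> p \<longrightarrow> norm (X x - L (x - p)) / norm (x - p) < 1"
    show "norm (X x) \<le> (M + 1) * norm (x - p)"
    proof (cases "x = p")
      case False
      then have "norm (X x - L (x - p)) < norm (x - p)" using * by (simp add: divide_simps)
      then show ?thesis
        using M[of "x - p"] norm_triangle_sub[of "X x" "L (x - p)"] by (simp add: algebra_simps)
    qed (simp add: assms(2))
  qed
  then show thesis by (rule that)
qed

text \<open>Since \<open>L (l y, y)\<close> and \<open>f (h y, y)\<close> vanish,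
  \<open>L (h y - l y, 0) = L (h y, y)\<close> is minus the remainder of \<open>f\<close> at
  \<open>(h y, y)\<close>. That remainder is quadratic in \<open>y\<close> because
  \<open>h y\<close> is of order \<open>norm y\<close>, and \<open>L\<close> is bounded below on the
  unknowns.\<close>

lemma implicit_function_leading_order:
  fixes f :: "'a::euclidean_space \<times> 'b::euclidean_space \<Rightarrow> 'a"
  assumes L: "bounded_linear L" and rem: "\<forall>\<^sub>F x in nhds 0. norm (f x - L x) \<le> C * (norm x)\<^sup>2"
    and inj: "\<And>u. L (u, 0) = 0 \<Longrightarrow> u = 0"
    and h: "(h has_derivative h') (at 0)" "h 0 = 0" "\<forall>\<^sub>F y in nhds 0. f (h y, y) = 0"
    and l: "\<And>y. L (l y, y) = 0"
  obtains K where "\<forall>\<^sub>F y in nhds 0. norm (h y - l y) \<le> K * (norm y)\<^sup>2"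
proof -
  \<comment> \<open>The sign of \<open>C\<close> is not given; its absolute value allows monotone
    estimates of the norm that it multiplies.\<close>
  have ev0: "C * (norm x)\<^sup>2 \<le> \<bar>C\<bar> * (norm x)\<^sup>2" for x :: "'a \<times> 'b"
    by (intro mult_right_mono) auto
  have lin: "linear (\<lambda>u. L (u, 0))"
    by (intro bounded_linear.linear bounded_linear_compose[OF L] bounded_linear_Pair
        bounded_linear_ident bounded_linear_zero)
  have "inj (\<lambda>u. L (u, 0))"
    using linear_injective_0[OF lin] inj by auto
  then obtain B where "B > 0" and B: "\<And>u. B * norm u \<le> norm (L (u, 0))"
    using linear_inj_bounded_below_pos[OF lin] by blast
  have "h differentiable (at 0)"
    using h(1) by (auto simp: differentiable_def)
  then obtain M where hb: "\<forall>\<^sub>F y in nhds 0. norm (h y) \<le> M * norm (y - 0)"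
    using h(2) by (rule differentiable_zero_linear_bound)
  have "((\<lambda>y. (h y, y)) \<longlongrightarrow> (h 0, 0)) (nhds 0)"
    using has_derivative_continuous[OF h(1)]
    by (intro tendsto_Pair) (auto simp: isCont_def tendsto_nhds_iff filterlim_ident)
  then have "\<forall>\<^sub>F y in nhds 0. norm (f (h y, y) - L (h y, y)) \<le> C * (norm (h y, y))\<^sup>2"
    using rem h(2) by (intro eventually_compose_filterlim[OF rem]) (simp add: zero_prod_def)
  then have "\<forall>\<^sub>F y in nhds 0. norm (h y - l y) \<le> \<bar>C\<bar> * (M + 1)\<^sup>2 / B * (norm y)\<^sup>2"
    using hb h(3)
  proof eventually_elim
    fix y
    assume 1: "norm (f (h y, y) - L (h y, y)) \<le> C * (norm (h y, y))\<^sup>2"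
      and 2: "norm (h y) \<le> M * norm (y - 0)" and 3: "f (h y, y) = 0"
    have "L (h y - l y, 0) = L (h y, y)"
      using linear_simps(2)[OF L, of "(h y, y)" "(l y, y)"] l[of y] by simp
    then have "B * norm (h y - l y) \<le> norm (L (h y, y))" using B by metis
    also have "\<dots> \<le> \<bar>C\<bar> * (norm (h y, y))\<^sup>2"
      using 1 3 ev0[of "(h y, y)"] by simp
    also have "norm (h y, y) \<le> (M + 1) * norm y"
      using norm_Pair_le[of "h y" y] 2 by (simp add: algebra_simps)
    then have "\<bar>C\<bar> * (norm (h y, y))\<^sup>2 \<le> \<bar>C\<bar> * ((M + 1) * norm y)\<^sup>2"
      by (intro mult_left_mono power_mono) auto
    finally show "norm (h y - l y) \<le> \<bar>C\<bar> * (M + 1)\<^sup>2 / B * (norm y)\<^sup>2"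
      unfolding power_mult_distrib using \<open>B > 0\<close> by (simp add: pos_le_divide_eq mult_ac)
  qed
  then show thesis by (rule that)
qed

section \<open>Solutions through equilibria of the amplitude equations\<close>

text \<open>The linear bound at \<open>p\<close> suffices for comparison with the solution resting
  at \<open>p\<close>. Near a time at which \<open>y\<close> is at \<open>p\<close>, a Gronwall
  argument in both time directions keeps the squared distance \<open>u\<close> at zero. The set of
  such times is thus open in \<open>I\<close>; it is closed by continuity, and \<open>I\<close> is
  connected.\<close>

lemma equilibrium_solution_constant:
  fixes X :: "'a::real_inner \<Rightarrow> 'a"
  assumes I: "is_interval I" and t0: "t0 \<in> I" "y t0 = p"
    and y: "\<And>t. t \<in> I \<Longrightarrow> (y has_vector_derivative X (y t)) (at t within I)"
    and X: "\<forall>\<^sub>F x in nhds p. norm (X x) \<le> K * norm (x - p)"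
    and t: "t \<in> I"
  shows "y t = p"
proof -
  define u where "u t = (y t - p) \<bullet> (y t - p)" for t
  \<comment> \<open>Derivatives within a subset \<open>J\<close> allow the mean value theorem on
    segments that may touch an end point of \<open>I\<close>.\<close>
  have der_u: "(u has_real_derivative 2 * ((y t - p) \<bullet> X (y t))) (at t within J)" if "t \<in> J" "J \<subseteq> I" for t J
  proof -
    have "(y has_derivative (\<lambda>h. h *\<^sub>R X (y t))) (at t within J)"
      using y[of t] that has_derivative_subset unfolding has_vector_derivative_def by blast
    then show ?thesis
      unfolding u_def has_field_derivative_def
      by (auto intro!: derivative_eq_intros simp: inner_commute fun_eq_iff algebra_simps)
  qed
  have cont: "continuous_on I y"
    using y by (meson has_vector_derivative_continuous continuous_on_eq_continuous_within)
  have *: "\<exists>d>0. \<forall>s\<in>I. dist s t1 < d \<longrightarrow> y s = p" if t1: "t1 \<in> I" "y t1 = p" for t1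
  proof -
    obtain e where e: "e > 0" "\<And>x. dist x p < e \<Longrightarrow> norm (X x) \<le> K * norm (x - p)"
      using X unfolding eventually_nhds_metric by blast
    obtain d where d: "d > 0" "\<And>s. s \<in> I \<Longrightarrow> dist s t1 < d \<Longrightarrow> dist (y s) p < e"
      using cont t1 e(1) unfolding continuous_on_iff by metis
    have slope: "\<bar>2 * ((y s - p) \<bullet> X (y s))\<bar> \<le> 2 * K * u s" if "s \<in> I" "dist s t1 < d" for s
    proof -
      have "\<bar>(y s - p) \<bullet> X (y s)\<bar> \<le> norm (y s - p) * norm (X (y s))"
        by (rule Cauchy_Schwarz_ineq2)
      also have "\<dots> \<le> norm (y s - p) * (K * norm (y s - p))"
        using e(2) d(2) that by (intro mult_left_mono) auto
      also have "\<dots> = K * u s"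
        by (simp add: u_def dot_square_norm power2_eq_square)
      finally show ?thesis by (simp add: abs_mult)
    qed
    have u0: "u t1 = 0" by (simp add: u_def t1)
    have "y s = p" if s: "s \<in> I" "dist s t1 < d" for s
    proof -
      have sub: "closed_segment t1 s \<subseteq> I"
        by (intro closed_segment_subset s t1) (use I is_interval_convex in blast)
      have near: "dist x t1 < d" if "x \<in> closed_segment t1 s" for x
        using that s(2) by (auto simp: closed_segment_eq_real_ivl dist_real_def split: if_splits)
      have "u s \<le> 0"
        \<comment> \<open>Gronwall: \<open>u t * exp (- 2 * K * t)\<close> decreases to the right of \<open>t1\<close> and
          \<open>u t * exp (2 * K * t)\<close> increases to the left of it.\<close>
      proof (cases "t1 \<le> s")
        case True
        then have seg: "closed_segment t1 s = {t1..s}" by (simp add: closed_segment_eq_real_ivl)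
        have "((\<lambda>t. u t * exp (- 2 * K * t)) has_derivative
           (\<lambda>h. h * ((2 * ((y x - p) \<bullet> X (y x)) - 2 * K * u x) * exp (- 2 * K * x)))) (at x within {t1..s})"
          if "t1 \<le> x" "x \<le> s" for x
          using der_u[of x "{t1..s}"] that sub seg
          by (subst mult.commute[of _ "(2 * ((y x - p) \<bullet> X (y x)) - 2 * K * u x) * exp (- 2 * K * x)"], subst has_field_derivative_def[symmetric])
             (auto intro!: derivative_eq_intros simp: algebra_simps)
        from mvt_very_simple[OF True this]
        obtain x where x: "x \<in> {t1..s}"
          and eq: "u s * exp (- 2 * K * s) - u t1 * exp (- 2 * K * t1)
            = (s - t1) * ((2 * ((y x - p) \<bullet> X (y x)) - 2 * K * u x) * exp (- 2 * K * x))" by blast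
        have "2 * ((y x - p) \<bullet> X (y x)) - 2 * K * u x \<le> 0"
          using slope[of x] x seg sub near by auto
        then have "u s * exp (- 2 * K * s) \<le> 0"
          using eq u0 True by (simp add: mult_nonneg_nonpos mult_nonpos_nonneg)
        then show ?thesis by (simp add: mult_le_0_iff not_le)
      next
        case False
        then have seg: "closed_segment t1 s = {s..t1}" and le: "s \<le> t1" by (simp_all add: closed_segment_eq_real_ivl)
        have "((\<lambda>t. u t * exp (2 * K * t)) has_derivative
           (\<lambda>h. h * ((2 * ((y x - p) \<bullet> X (y x)) + 2 * K * u x) * exp (2 * K * x)))) (at x within {s..t1})"
          if "s \<le> x" "x \<le> t1" for x
          using der_u[of x "{s..t1}"] that sub seg
          by (subst mult.commute[of _ "(2 * ((y x - p) \<bullet> X (y x)) + 2 * K * u x) * exp (2 * K * x)"], subst has_field_derivative_def[symmetric])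
             (auto intro!: derivative_eq_intros simp: algebra_simps)
        from mvt_very_simple[OF le this]
        obtain x where x: "x \<in> {s..t1}"
          and eq: "u t1 * exp (2 * K * t1) - u s * exp (2 * K * s)
            = (t1 - s) * ((2 * ((y x - p) \<bullet> X (y x)) + 2 * K * u x) * exp (2 * K * x))" by blast
        have "2 * ((y x - p) \<bullet> X (y x)) + 2 * K * u x \<ge> 0"
          using slope[of x] x seg sub near by auto
        then have "0 \<le> - u s * exp (2 * K * s)"
          using eq u0 le by simp
        then show ?thesis by (simp add: mult_le_0_iff not_le)
      qed
      then show "y s = p" by (simp add: u_def dot_square_norm)
    qed
    then show ?thesis using d(1) by blast
  qed
  define T where "T = {s \<in> I. y s = p}"
  have "openin (top_of_set I) T"
    unfolding openin_euclidean_subtopology_iff using * by (auto simp: T_def)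
  moreover have "closedin (top_of_set I) T"
    unfolding T_def by (rule continuous_closedin_preimage_constant[OF cont])
  moreover have "connected I"
    using I is_interval_connected by blast
  ultimately have "T = {} \<or> T = I"
    by (meson connected_clopen)
  then show ?thesis using t t0 by (auto simp: T_def)
qed

text \<open>At rest amplitudes the phase speeds are constant, so the phases are affine in time. The
  equilibrium conditions keep the factors \<open>r\<close> and \<open>\<rho>\<close>, so that one
  statement serves both axes and the interior.\<close>

lemma rotating_solution:
  assumes "0 \<le> r" "0 \<le> \<rho>" "(r\<^sup>2, \<rho>\<^sup>2, \<alpha>) \<in> W"
    and "r * F (r\<^sup>2, \<rho>\<^sup>2, \<alpha>) = 0" "\<rho> * G (r\<^sup>2, \<rho>\<^sup>2, \<alpha>) = 0"
    and "u \<in> sphere 0 1" "v \<in> sphere 0 1"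
  shows "is_solution (flow_field F G \<Theta> \<Phi> \<alpha>) (flow_domain W \<alpha>) I
    (\<lambda>t. (r * (u * cis (\<Theta> (r, \<rho>, \<alpha>) * t)), \<rho> * (v * cis (\<Phi> (r, \<rho>, \<alpha>) * t))))"
proof -
  obtain a b where \<alpha>: "\<alpha> = (a, b)" by force
  obtain \<theta> \<phi> where uv: "u = cis \<theta>" "v = cis \<phi>"
    using complex_norm_eq_1_exp assms(6,7) by (metis cis_conv_exp mem_sphere_0)
  have "is_solution (flow_field F G \<Theta> \<Phi> (a, b)) (flow_domain W (a, b)) I
     (\<lambda>t. (r * cis (\<theta> + \<Theta> (r, \<rho>, a, b) * t), \<rho> * cis (\<phi> + \<Phi> (r, \<rho>, a, b) * t)))"
    using assms(1-5) by (intro polar_solution) (auto simp: \<alpha> intro!: derivative_eq_intros)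
  then show ?thesis
    by (simp add: \<alpha> uv cis_mult)
qed

lemma sphere_eq_range_cis:
  assumes "0 \<le> r" "\<omega> \<noteq> 0"
  shows "sphere 0 r = range (\<lambda>t. of_real r * cis (\<omega> * t))"
proof (intro set_eqI iffI)
  fix z :: complex assume "z \<in> sphere 0 r"
  then have "z = of_real r * cis (\<omega> * (Arg z / \<omega>))"
    using rcis_cmod_Arg[of z] assms(2) by (simp add: rcis_def)
  then show "z \<in> range (\<lambda>t. of_real r * cis (\<omega> * t))" by blast
qed (use assms in \<open>auto simp: norm_mult\<close>)

lemma rotation_period:
  assumes "\<omega> > 0"
  shows "cis (\<omega> * (t + 2 * pi / \<omega>)) = cis (\<omega> * t)"
  using assms by (simp add: distrib_left complex_eq_iff)

lemma rotation_not_constant: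
  assumes "\<omega> \<noteq> 0" "r \<noteq> 0"
  shows "\<not> (\<lambda>t. of_real r * cis (\<omega> * t)) constant_on UNIV"
proof
  assume "(\<lambda>t. of_real r * cis (\<omega> * t)) constant_on UNIV"
  \<comment> \<open>After time \<open>pi / \<omega>\<close> the rotation has made half a turn and
    reversed the sign.\<close>
  then have "of_real r * cis (\<omega> * 0) = of_real r * cis (\<omega> * (pi / \<omega>))"
    unfolding constant_on_def by (metis UNIV_I)
  then show False using assms by simp
qed

text \<open>The second amplitude is 0, so its equation holds trivially; the positive speed of the
  first phase makes \<open>2 * pi / \<Theta> (r, 0, \<alpha>)\<close> a positive period.\<close>

lemma periodic_orbit_axis1:
  assumes "0 < r" "(r\<^sup>2, 0, \<alpha>) \<in> W" "F (r\<^sup>2, 0, \<alpha>) = 0" "\<Theta> (r, 0, \<alpha>) > 0"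
  shows "periodic_orbit (flow_field F G \<Theta> \<Phi> \<alpha>) (flow_domain W \<alpha>) (sphere 0 r \<times> {0})"
proof -
  let ?\<omega> = "\<Theta> (r, 0, \<alpha>)"
  let ?x = "\<lambda>t. (of_real r * cis (?\<omega> * t), 0 :: complex)"
  have "is_solution (flow_field F G \<Theta> \<Phi> \<alpha>) (flow_domain W \<alpha>) UNIV ?x"
    using rotating_solution[of r 0 \<alpha> W F G 1 1 \<Theta> \<Phi> UNIV] assms by simp
  moreover have "\<not> ?x constant_on UNIV"
    using rotation_not_constant[of ?\<omega> r] assms unfolding constant_on_def by fastforce
  moreover have "sphere 0 r \<times> {0} = range ?x"
    using sphere_eq_range_cis[of r ?\<omega>] assms by auto
  ultimately show ?thesis
    unfolding periodic_orbit_def using assms rotation_period[OF assms(4)]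
    by (intro exI[of _ ?x] exI[of _ "2 * pi / ?\<omega>"]) auto
qed

lemma periodic_orbit_axis2:
  assumes "0 < \<rho>" "(0, \<rho>\<^sup>2, \<alpha>) \<in> W" "G (0, \<rho>\<^sup>2, \<alpha>) = 0" "\<Phi> (0, \<rho>, \<alpha>) > 0"
  shows "periodic_orbit (flow_field F G \<Theta> \<Phi> \<alpha>) (flow_domain W \<alpha>) ({0} \<times> sphere 0 \<rho>)"
proof -
  let ?\<omega> = "\<Phi> (0, \<rho>, \<alpha>)"
  let ?x = "\<lambda>t. (0 :: complex, of_real \<rho> * cis (?\<omega> * t))"
  have "is_solution (flow_field F G \<Theta> \<Phi> \<alpha>) (flow_domain W \<alpha>) UNIV ?x"
    using rotating_solution[of 0 \<rho> \<alpha> W F G 1 1 \<Theta> \<Phi> UNIV] assms by simp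
  moreover have "\<not> ?x constant_on UNIV"
    using rotation_not_constant[of ?\<omega> \<rho>] assms unfolding constant_on_def by fastforce
  moreover have "{0} \<times> sphere 0 \<rho> = range ?x"
    using sphere_eq_range_cis[of \<rho> ?\<omega>] assms by auto
  ultimately show ?thesis
    unfolding periodic_orbit_def using assms rotation_period[OF assms(4)]
    by (intro exI[of _ ?x] exI[of _ "2 * pi / ?\<omega>"]) auto
qed

text \<open>The imaginary part \<open>b\<close> only rotates \<open>z\<close> and cancels in the
  squared modulus. This decouples the amplitudes from the phases without choosing angles, also where
  \<open>z\<close> vanishes.\<close>

lemma cmod_squared_derivative:
  assumes "(z has_vector_derivative z t * Complex a b) (at t within I)"
  shows "((\<lambda>t. (cmod (z t))\<^sup>2) has_real_derivative 2 * (cmod (z t))\<^sup>2 * a) (at t within I)"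
proof -
  have "((\<lambda>t. Re (z t)) has_real_derivative Re (z t) * a - Im (z t) * b) (at t within I)"
    "((\<lambda>t. Im (z t)) has_real_derivative Re (z t) * b + Im (z t) * a) (at t within I)"
    using assms by (auto simp: has_vector_derivative_complex_iff)
  from DERIV_add[OF DERIV_power[OF this(1), of 2] DERIV_power[OF this(2), of 2]]
  show ?thesis
    unfolding cmod_power2 by (simp add: algebra_simps power2_eq_square)
qed

text \<open>Multiplying by the opposite rotation gives a function with zero derivative on the convex
  set \<open>I\<close>, hence a constant.\<close>

lemma rotation_unique:
  assumes "convex I" "0 \<in> I" "t \<in> I"
    and z: "\<And>t. t \<in> I \<Longrightarrow> (z has_vector_derivative z t * Complex 0 \<omega>) (at t within I)"
  shows "z t = z 0 * cis (\<omega> * t)"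
proof -
  have cis': "((\<lambda>t. cis (- (\<omega> * t))) has_vector_derivative - (\<i> * \<omega>) * cis (- (\<omega> * t))) (at t within I)" for t
    by (auto simp: has_vector_derivative_complex_iff intro!: derivative_eq_intros)
  have "((\<lambda>t. z t * cis (- (\<omega> * t))) has_vector_derivative 0) (at t within I)" if "t \<in> I" for t
    using has_vector_derivative_mult[OF z[OF that] cis'[of t]]
    by (simp add: Complex_eq algebra_simps)
  then obtain c where c: "\<And>t. t \<in> I \<Longrightarrow> z t * cis (- (\<omega> * t)) = c"
    using has_vector_derivative_zero_constant[OF assms(1)] by blast
  have "z t * cis (- (\<omega> * t)) = z 0"
    using c[OF assms(2)] c[OF assms(3)] by simp
  then have "z t * (cis (- (\<omega> * t)) * cis (\<omega> * t)) = z 0 * cis (\<omega> * t)"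
    by (simp add: mult.assoc[symmetric] del: cis_mult)
  then show ?thesis by (simp add: cis_mult)
qed

lemma two_frequency_torus_equilibrium:
  assumes r: "0 < r" "0 < \<rho>" and W: "(r\<^sup>2, \<rho>\<^sup>2, \<alpha>) \<in> W"
    and eq: "F (r\<^sup>2, \<rho>\<^sup>2, \<alpha>) = 0" "G (r\<^sup>2, \<rho>\<^sup>2, \<alpha>) = 0"
    and diff: "F differentiable (at (r\<^sup>2, \<rho>\<^sup>2, \<alpha>))" "G differentiable (at (r\<^sup>2, \<rho>\<^sup>2, \<alpha>))"
    and freq: "\<Theta> (r, \<rho>, \<alpha>) \<noteq> 0" "\<Phi> (r, \<rho>, \<alpha>) \<noteq> 0"
  shows "two_frequency_torus (flow_field F G \<Theta> \<Phi> \<alpha>) (flow_domain W \<alpha>) (sphere 0 r \<times> sphere 0 \<rho>)"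
proof -
  let ?X = "flow_field F G \<Theta> \<Phi> \<alpha>" and ?D = "flow_domain W \<alpha>" and ?M = "sphere (0::complex) r \<times> sphere (0::complex) \<rho>"
  let ?\<omega>1 = "\<Theta> (r, \<rho>, \<alpha>)" and ?\<omega>2 = "\<Phi> (r, \<rho>, \<alpha>)"
  obtain a b where \<alpha>: "\<alpha> = (a, b)" by force
  \<comment> \<open>The conjugating homeomorphism merely scales the two unit circles to radii
    \<open>r\<close> and \<open>\<rho>\<close>; both radii are positive, so scaling back is
    possible.\<close>
  define h where "h = (\<lambda>(u, v). (of_real r * u, of_real \<rho> * v) :: complex \<times> complex)"
  define k where "k = (\<lambda>(z, w). (z / of_real r, w / of_real \<rho>) :: complex \<times> complex)"
  have hom: "homeomorphism (sphere 0 1 \<times> sphere 0 1) ?M h k"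
  proof (rule homeomorphismI)
    show "continuous_on (sphere 0 1 \<times> sphere 0 1) h" "continuous_on ?M k"
      using r by (auto simp: h_def k_def case_prod_unfold intro!: continuous_intros)
  qed (use r in \<open>auto simp: h_def k_def norm_mult norm_divide\<close>)
  have sol: "is_solution ?X ?D UNIV (\<lambda>t. h (u * cis (?\<omega>1 * t), v * cis (?\<omega>2 * t)))"
    if "u \<in> sphere 0 1" "v \<in> sphere 0 1" for u v
    using rotating_solution[of r \<rho> \<alpha> W F G u v \<Theta> \<Phi> UNIV] r W eq that by (simp add: h_def)
  have uniq: "\<exists>u\<in>sphere 0 1. \<exists>v\<in>sphere 0 1. \<forall>t\<in>I. x t = h (u * cis (?\<omega>1 * t), v * cis (?\<omega>2 * t))"
    if I: "is_interval I" "0 \<in> I" and x: "is_solution ?X ?D I x" "x 0 \<in> ?M" for I x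
  proof -
    define z where "z t = fst (x t)" for t
    define w where "w t = snd (x t)" for t
    have zw: "x t = (z t, w t)" for t by (simp add: z_def w_def)
    let ?N = "\<lambda>t. ((cmod (z t))\<^sup>2, (cmod (w t))\<^sup>2)"
    have dx: "(x has_vector_derivative ?X (z t, w t)) (at t within I)" if "t \<in> I" for t
      using x(1) that by (auto simp: is_solution_def zw)
    have dz: "(z has_vector_derivative z t * Complex (F ((cmod (z t))\<^sup>2, (cmod (w t))\<^sup>2, \<alpha>)) (\<Theta> (cmod (z t), cmod (w t), \<alpha>)))
        (at t within I)" if "t \<in> I" for t
      using bounded_linear.has_vector_derivative[OF bounded_linear_fst dx[OF that]]
      by (simp add: \<alpha> flip: z_def)
    have dw: "(w has_vector_derivative w t * Complex (G ((cmod (z t))\<^sup>2, (cmod (w t))\<^sup>2, \<alpha>)) (\<Phi> (cmod (z t), cmod (w t), \<alpha>)))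
        (at t within I)" if "t \<in> I" for t
      using bounded_linear.has_vector_derivative[OF bounded_linear_snd dx[OF that]]
      by (simp add: \<alpha> flip: w_def)
    \<comment> \<open>The autonomous field that governs the squared moduli of an arbitrary solution.
      It vanishes at \<open>(r\<^sup>2, \<rho>\<^sup>2)\<close> and is differentiable there, so a
      solution starting on the torus keeps its moduli.\<close>
    define Y where "Y = (\<lambda>(R, S). (2 * R * F (R, S, \<alpha>), 2 * S * G (R, S, \<alpha>)))"
    have dN: "(?N has_vector_derivative Y (?N t)) (at t within I)" if "t \<in> I" for t
      using cmod_squared_derivative[OF dz[OF that]] cmod_squared_derivative[OF dw[OF that]]
      by (auto simp: Y_def has_real_derivative_iff_has_vector_derivative intro!: has_vector_derivative_Pair)
    \<comment> \<open>Freezing the parameters transfers differentiability from four variables to the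
      \<open>(R, S)\<close> plane.\<close>
    have incl: "((\<lambda>p. (fst p, snd p, \<alpha>)) has_derivative (\<lambda>p. (fst p, snd p, 0))) (at (r\<^sup>2, \<rho>\<^sup>2))"
      by (auto intro!: derivative_eq_intros)
    have "(\<lambda>p. f (fst p, snd p, \<alpha>)) differentiable (at (r\<^sup>2, \<rho>\<^sup>2))"
      if "f differentiable (at (r\<^sup>2, \<rho>\<^sup>2, \<alpha>))" for f :: "real \<times> real \<times> real \<times> real \<Rightarrow> real"
      using that has_derivative_compose[OF incl] unfolding differentiable_def by fastforce
    note dF = this[OF diff(1)] this[OF diff(2)]
    then have "Y differentiable (at (r\<^sup>2, \<rho>\<^sup>2))"
      unfolding Y_def case_prod_unfold differentiable_def
      by (fastforce intro!: derivative_intros)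
    moreover have "Y (r\<^sup>2, \<rho>\<^sup>2) = 0"
      by (simp add: Y_def eq zero_prod_def)
    ultimately obtain K where K: "\<forall>\<^sub>F p in nhds (r\<^sup>2, \<rho>\<^sup>2). norm (Y p) \<le> K * norm (p - (r\<^sup>2, \<rho>\<^sup>2))"
      by (rule differentiable_zero_linear_bound)
    have z0: "cmod (z 0) = r" "cmod (w 0) = \<rho>"
      using x(2) by (auto simp: zw)
    have "?N t = (r\<^sup>2, \<rho>\<^sup>2)" if "t \<in> I" for t
      by (rule equilibrium_solution_constant[OF I _ dN K that]) (simp_all add: z0)
    then have cm: "cmod (z t) = r" "cmod (w t) = \<rho>" if "t \<in> I" for t
      using that r by auto
    have conv: "convex I" using I(1) is_interval_convex by blast
    \<comment> \<open>With constant moduli the brackets vanish and the phase speeds are the fixed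
      frequencies, which leaves a linear equation for each component.\<close>
    have zt: "z t = z 0 * cis (?\<omega>1 * t)" if "t \<in> I" for t
      using dz cm eq by (intro rotation_unique[OF conv I(2) that]) fastforce
    have wt: "w t = w 0 * cis (?\<omega>2 * t)" if "t \<in> I" for t
      using dw cm eq by (intro rotation_unique[OF conv I(2) that]) fastforce
    show ?thesis
      using r z0 zt wt
      by (intro bexI[of _ "z 0 / r"] bexI[of _ "w 0 / \<rho>"])
        (auto simp: zw h_def norm_divide)
  qed
  have "invariant_under ?X ?D ?M"
    unfolding invariant_under_def
  proof (intro allI impI ballI)
    fix I x t
    assume "is_interval I \<and> 0 \<in> I \<and> is_solution ?X ?D I x \<and> x 0 \<in> ?M" and t: "t \<in> I"
    then obtain u v where "u \<in> sphere 0 1" "v \<in> sphere 0 1"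
      "x t = h (u * cis (?\<omega>1 * t), v * cis (?\<omega>2 * t))"
      using uniq by meson
    then show "x t \<in> ?M" using r by (auto simp: h_def norm_mult)
  qed
  then show ?thesis
    unfolding two_frequency_torus_def using hom freq sol uniq
    by (intro conjI exI[of _ h] exI[of _ k] exI[of _ ?\<omega>1] exI[of _ ?\<omega>2]) auto
qed

section \<open>The bifurcation set\<close>

text \<open>Exchanging the two amplitudes preserves limits in both directions; this reduces
  branching from the third family to branching from the second.\<close>

lemma bifurcates_from_swap:
  "bifurcates_from E' (\<lambda>a. prod.swap (p' a)) E (\<lambda>a. prod.swap (p a)) a \<longleftrightarrow> bifurcates_from E' p' E p a"
proof -
  have "((\<lambda>a. prod.swap (p' a)) \<longlongrightarrow> prod.swap (p a)) F \<longleftrightarrow> (p' \<longlongrightarrow> p a) F" for F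
  proof
    assume "(p' \<longlongrightarrow> p a) F"
    then show "((\<lambda>a. prod.swap (p' a)) \<longlongrightarrow> prod.swap (p a)) F"
      unfolding prod.swap_def by (intro tendsto_intros)
  next
    assume "((\<lambda>a. prod.swap (p' a)) \<longlongrightarrow> prod.swap (p a)) F"
    from tendsto_Pair[OF tendsto_snd[OF this] tendsto_fst[OF this]]
    show "(p' \<longlongrightarrow> p a) F" by simp
  qed
  then show ?thesis by (simp add: bifurcates_from_def)
qed

text \<open>At a bifurcation point the limit of the branching family forces \<open>Q\<close> to be 0
  and \<open>P\<close> to equal \<open>A\<close>, which is positive there, so the point is
  \<open>\<gamma> (P a, 0)\<close>. Conversely, from \<open>\<gamma> (s, 0)\<close> the points
  \<open>\<gamma> (s, q)\<close> enter \<open>?E'\<close> for small \<open>q > 0\<close> and leave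
  it for small \<open>q < 0\<close>.\<close>

lemma bifurcation_set:
  fixes A P Q :: "'a::metric_space \<Rightarrow> real" and \<gamma> :: "real \<times> real \<Rightarrow> 'a"
  assumes V: "open V" and cont: "continuous_on V A" "continuous_on V P" "continuous_on V Q"
    and bound: "\<And>\<alpha>. \<alpha> \<in> V \<Longrightarrow> \<bar>P \<alpha>\<bar> < \<epsilon> \<and> \<bar>Q \<alpha>\<bar> < \<epsilon>"
    and inverse: "\<And>\<alpha> R S. \<alpha> \<in> V \<Longrightarrow> \<bar>R\<bar> < \<epsilon> \<Longrightarrow> \<bar>S\<bar> < \<epsilon> \<Longrightarrow> \<alpha> = \<gamma> (R, S) \<longleftrightarrow> (R, S) = (P \<alpha>, Q \<alpha>)"
    and \<gamma>: "continuous_on ({- \<epsilon> <..< \<epsilon>} \<times> {- \<epsilon> <..< \<epsilon>}) \<gamma>"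
    and axis: "\<And>\<alpha>. \<alpha> \<in> V \<Longrightarrow> Q \<alpha> = 0 \<Longrightarrow> A \<alpha> = P \<alpha>"
  shows "{\<alpha>\<in>V. bifurcates_from
        {\<alpha>\<in>V. 0 < P \<alpha> \<and> 0 < Q \<alpha>} (\<lambda>\<alpha>. (sqrt (P \<alpha>), sqrt (Q \<alpha>)))
        {\<alpha>\<in>V. 0 < A \<alpha>} (\<lambda>\<alpha>. (sqrt (A \<alpha>), 0)) \<alpha>} = V \<inter> (\<lambda>s. \<gamma> (s, 0)) ` {0 <..< \<epsilon>}"
    (is "{\<alpha>\<in>V. bifurcates_from ?E' ?p' ?E ?p \<alpha>} = ?B")
proof (intro set_eqI iffI)
  have tends: "(f \<longlongrightarrow> f a) (at a within E)" if "continuous_on V f" "a \<in> V" for f :: "'a \<Rightarrow> real" and a E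
    using that V by (metis continuous_on_eq_continuous_at isCont_def tendsto_within_subset subset_UNIV)
  fix a
  {
    assume "a \<in> {\<alpha>\<in>V. bifurcates_from ?E' ?p' ?E ?p \<alpha>}"
    then have a: "a \<in> V" "a \<in> interior ?E" "a \<notin> ?E'" "a \<in> closure ?E'"
      and lim: "(?p' \<longlongrightarrow> ?p a) (at a within ?E')"
      by (auto simp: bifurcates_from_def)
    have Aa: "A a > 0"
      using a(2) interior_subset by blast
    \<comment> \<open>As \<open>a\<close> lies in the closure of \<open>?E'\<close> but not in
      \<open>?E'\<close>, it is a limit point, so limits along \<open>?E'\<close> are
      unique.\<close>
    have nt: "at a within ?E' \<noteq> bot"
      using a(3,4) by (metis at_within_eq_bot_iff Diff_empty Diff_insert0)
    have "sqrt (P a) = sqrt (A a)"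
      using tendsto_unique[OF nt tendsto_real_sqrt[OF tends[OF cont(2) a(1)]]] tendsto_fst[OF lim]
      by simp
    \<comment> \<open>The real \<open>sqrt\<close> is odd and injective on all reals, so no sign
      condition on \<open>P a\<close> is involved; likewise for \<open>Q a\<close> below.\<close>
    then have PA: "P a = A a" by simp
    have "sqrt (Q a) = 0"
      using tendsto_unique[OF nt tendsto_real_sqrt[OF tends[OF cont(3) a(1)]]] tendsto_snd[OF lim]
      by simp
    then have "Q a = 0" by simp
    then have "a = \<gamma> (P a, 0)"
      using inverse[of a "P a" 0] bound[OF a(1)] a(1) by auto
    then show "a \<in> ?B"
      using Aa PA bound[OF a(1)] a(1) by (auto intro!: image_eqI[of _ _ "P a"])
  }
  {
    assume "a \<in> ?B"
    then obtain s where s: "0 < s" "s < \<epsilon>" and a: "a = \<gamma> (s, 0)" "a \<in> V" by auto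
    then have PQ: "P a = s" "Q a = 0"
      using inverse[of a s 0] by auto
    then have Aa: "A a = s" using axis a by auto
    have open_preimage: "open {\<alpha>\<in>V. f \<alpha> \<in> T}" if "continuous_on V f" "open T" for f :: "'a \<Rightarrow> real" and T
      using continuous_open_preimage[OF that(1) V that(2)] by (simp add: Collect_conj_eq vimage_def)
    have oE: "open {\<alpha>\<in>V. 0 < A \<alpha>}" and oQ: "open {\<alpha>\<in>V. Q \<alpha> < 0}"
      using open_preimage[OF cont(1) open_greaterThan[of 0]] open_preimage[OF cont(3) open_lessThan[of 0]]
      by simp_all
    have near: "(\<lambda>q. \<gamma> (s, q)) \<midarrow>0\<rightarrow> a"
    proof -
      have "isCont \<gamma> (s, 0)"
        using \<gamma> s by (subst (asm) continuous_on_eq_continuous_at) (auto intro!: open_Times)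
      moreover have "isCont (\<lambda>q. (s, q)) 0"
        by (intro continuous_intros)
      ultimately have "isCont (\<lambda>q. \<gamma> (s, q)) 0"
        by (metis isCont_o2)
      then show ?thesis by (simp add: isCont_def a)
    qed
    \<comment> \<open>The sign \<open>\<sigma>\<close> selects the side of the half-axis from which
      \<open>a\<close> is approached.\<close>
    have close: "\<exists>q. \<bar>q\<bar> < \<epsilon> \<and> q \<noteq> 0 \<and> sgn q = \<sigma> \<and> \<gamma> (s, q) \<in> V \<and> dist (\<gamma> (s, q)) a < e"
      if "e > 0" "\<sigma> = 1 \<or> \<sigma> = -1" for e \<sigma> :: real
    proof -
      have "\<forall>\<^sub>F q in at 0. \<gamma> (s, q) \<in> V \<and> dist (\<gamma> (s, q)) a < e"
        using tendstoD[OF near that(1)] topological_tendstoD[OF near V a(2)]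
        by (rule eventually_elim2) auto
      then obtain d where d: "d > 0" "\<And>q. q \<noteq> 0 \<Longrightarrow> \<bar>q\<bar> < d \<Longrightarrow> \<gamma> (s, q) \<in> V \<and> dist (\<gamma> (s, q)) a < e"
        unfolding eventually_at by (auto simp: dist_norm)
      define q where "q = \<sigma> * (min d \<epsilon> / 2)"
      have "\<bar>q\<bar> < \<epsilon>" "\<bar>q\<bar> < d" "q \<noteq> 0" "sgn q = \<sigma>"
        using that d(1) s by (auto simp: q_def abs_mult sgn_mult)
      then show ?thesis using d by blast
    qed
    have val: "P (\<gamma> (s, q)) = s \<and> Q (\<gamma> (s, q)) = q" if "\<bar>q\<bar> < \<epsilon>" "\<gamma> (s, q) \<in> V" for q
      using inverse[of "\<gamma> (s, q)" s q] that s by auto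
    have c1: "a \<in> closure ?E'"
      unfolding closure_approachable
    proof (intro allI impI)
      fix e :: real assume "e > 0"
      then obtain q where "\<bar>q\<bar> < \<epsilon>" "sgn q = 1" "\<gamma> (s, q) \<in> V" "dist (\<gamma> (s, q)) a < e"
        using close[of e 1] by auto
      then show "\<exists>y\<in>?E'. dist y a < e"
        using val[of q] s by (intro bexI[of _ "\<gamma> (s, q)"]) (auto simp: sgn_if split: if_splits)
    qed
    have c2: "a \<in> closure {\<alpha>\<in>V. Q \<alpha> < 0}"
      unfolding closure_approachable
    proof (intro allI impI)
      fix e :: real assume "e > 0"
      then obtain q where "\<bar>q\<bar> < \<epsilon>" "sgn q = -1" "\<gamma> (s, q) \<in> V" "dist (\<gamma> (s, q)) a < e"
        using close[of e "-1"] by auto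
      then show "\<exists>y\<in>{\<alpha>\<in>V. Q \<alpha> < 0}. dist y a < e"
        using val[of q] s by (intro bexI[of _ "\<gamma> (s, q)"]) (auto simp: sgn_if split: if_splits)
    qed
    have "{\<alpha>\<in>V. Q \<alpha> < 0} \<subseteq> interior (- ?E')"
      by (intro interior_maximal oQ) auto
    then have c3: "a \<in> closure (interior (- ?E'))"
      using c2 closure_mono by blast
    have "(?p' \<longlongrightarrow> (sqrt (P a), sqrt (Q a))) (at a within ?E')"
      by (intro tendsto_intros tends cont a)
    then have "(?p' \<longlongrightarrow> ?p a) (at a within ?E')"
      by (simp add: PQ Aa)
    then show "a \<in> {\<alpha>\<in>V. bifurcates_from ?E' ?p' ?E ?p \<alpha>}"
      using a c1 c3 oE Aa s PQ by (simp add: bifurcates_from_def interior_open)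
  }
qed

section \<open>Solution branches of the amplitude equations\<close>

lemma smooth_on_imp_C1:
  assumes "smooth_on W f"
  shows "x \<in> W \<Longrightarrow> (f has_derivative frechet_derivative f (at x)) (at x)"
    and "continuous_on W (\<lambda>x. frechet_derivative f (at x) v)"
proof -
  have "Ck_on (Suc 0) W f"
    using assms unfolding smooth_on_def by blast
  then show "x \<in> W \<Longrightarrow> (f has_derivative frechet_derivative f (at x)) (at x)"
    and "continuous_on W (\<lambda>x. frechet_derivative f (at x) v)"
    by (simp_all add: frechet_derivative_works)
qed

text \<open>A common frame for several implicit problems about one map \<open>H\<close>: the linear
  map \<open>J\<close> places unknowns and parameters among the variables of \<open>H\<close>, and
  \<open>K\<close> selects the equations to be solved. The function \<open>l\<close> solves the
  linearised problem and gives the leading order.\<close>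

lemma implicit_solution_branch:
  fixes H :: "'c::euclidean_space \<Rightarrow> 'd::euclidean_space"
    and J :: "'a::euclidean_space \<times> 'b::euclidean_space \<Rightarrow> 'c" and K :: "'d \<Rightarrow> 'a"
  assumes W: "open W" "0 \<in> W"
    and der: "\<And>x. x \<in> W \<Longrightarrow> (H has_derivative H' x) (at x)"
    and cont: "\<And>v. continuous_on W (\<lambda>x. H' x v)"
    and L: "bounded_linear L" and rem: "\<forall>\<^sub>F x in nhds 0. norm (H x - L x) \<le> C * (norm x)\<^sup>2"
    and J: "bounded_linear J" and K: "bounded_linear K"
    and inj: "\<And>u. K (L (J (u, 0))) = 0 \<Longrightarrow> u = 0"
    and l: "\<And>y. K (L (J (l y, y))) = 0"
  obtains X Y h h' M where "open X" "0 \<in> X" "open Y" "0 \<in> Y" "h 0 = 0"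
    "\<And>x y. x \<in> X \<Longrightarrow> y \<in> Y \<Longrightarrow> J (x, y) \<in> W"
    "\<And>x y. x \<in> X \<Longrightarrow> y \<in> Y \<Longrightarrow> K (H (J (x, y))) = 0 \<longleftrightarrow> x = h y"
    "\<And>y. y \<in> Y \<Longrightarrow> (h has_derivative h' y) (at y)"
    "\<And>v. continuous_on Y (\<lambda>y. h' y v)"
    "\<forall>\<^sub>F y in nhds 0. norm (h y - l y) \<le> M * (norm y)\<^sup>2"
proof -
  define f where "f x = K (H (J x))" for x
  define f' where "f' x v = K (H' (J x) (J v))" for x v
  define \<Lambda> where "\<Lambda> x = K (L (J x))" for x
  have \<Lambda>: "bounded_linear \<Lambda>"
    unfolding \<Lambda>_def by (intro bounded_linear_compose[OF K] bounded_linear_compose[OF L] J)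
  have J0: "J 0 = 0" and K0: "K 0 = 0"
    using J K by (simp_all add: linear_simps)
  have contJ: "continuous_on A J" for A
    by (intro linear_continuous_on J)
  have der_f: "(f has_derivative f' x) (at x)" if "x \<in> J -` W" for x
    unfolding f_def f'_def
    using that by (intro bounded_linear.has_derivative[OF K] has_derivative_compose[OF bounded_linear_imp_has_derivative[OF J] der]) auto
  have cont_f: "continuous_on (J -` W) (\<lambda>x. f' x v)" for v
    unfolding f'_def
    by (intro continuous_on_compose2[OF linear_continuous_on[OF K, of UNIV]] continuous_on_compose2[OF cont contJ]) auto
  obtain k where k: "\<And>x. norm (K x) \<le> norm x * k" "k > 0"
    using bounded_linear.pos_bounded[OF K] by blast
  obtain j where j: "\<And>x. norm (J x) \<le> norm x * j" "j > 0"
    using bounded_linear.pos_bounded[OF J] by blast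
  have "((\<lambda>x. J x) \<longlongrightarrow> 0) (nhds 0)"
    using linear_continuous_at[OF J, of 0] tendsto_at_iff_tendsto_nhds[of J 0] by (simp add: continuous_at J0)
  from eventually_compose_filterlim[OF rem this]
  have rem_f: "\<forall>\<^sub>F x in nhds 0. norm (f x - \<Lambda> x) \<le> (\<bar>C\<bar> * j\<^sup>2 * k) * (norm x)\<^sup>2"
  proof eventually_elim
    fix x assume *: "norm (H (J x) - L (J x)) \<le> C * (norm (J x))\<^sup>2"
    have "norm (f x - \<Lambda> x) = norm (K (H (J x) - L (J x)))"
      by (simp add: f_def \<Lambda>_def linear_simps(2)[OF K])
    also have "\<dots> \<le> (C * (norm (J x))\<^sup>2) * k"
      by (rule order_trans[OF k(1) mult_right_mono[OF *]]) (use k in simp)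
    also have "\<dots> \<le> (\<bar>C\<bar> * (norm x * j)\<^sup>2) * k"
      using k j by (intro mult_right_mono mult_mono power_mono) auto
    finally show "norm (f x - \<Lambda> x) \<le> (\<bar>C\<bar> * j\<^sup>2 * k) * (norm x)\<^sup>2"
      by (simp add: power_mult_distrib mult_ac)
  qed
  have f0: "f 0 = 0" and "(f has_derivative \<Lambda>) (at 0)"
    using has_derivative_quadratic_remainder[OF \<Lambda> rem_f] by auto
  \<comment> \<open>The chain-rule derivative and the linear part of the expansion are both
    derivatives of \<open>f\<close> at 0; hence injectivity can be checked on the explicit linear
    part.\<close>
  then have f'0: "f' 0 = \<Lambda>"
    using has_derivative_unique der_f[of 0] by (auto simp: J0 W)
  have oJ: "open (J -` W)"
    using contJ[of UNIV] W(1) by (intro open_vimage) auto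
  have z: "0 \<in> J -` W" by (simp add: J0 W)
  have inj_f: "u = 0" if "f' 0 (u, 0) = 0" for u
    using that inj by (simp add: f'0 \<Lambda>_def)
  show thesis
  proof (rule implicit_function_theorem[OF oJ z f0 der_f cont_f inj_f])
    fix X Y h h'
    assume XY: "open X" "0 \<in> X" "open Y" "0 \<in> Y" "X \<times> Y \<subseteq> J -` W" "h 0 = 0"
        "\<And>y. y \<in> Y \<Longrightarrow> h y \<in> X"
      and zero: "\<And>x y. x \<in> X \<Longrightarrow> y \<in> Y \<Longrightarrow> f (x, y) = 0 \<longleftrightarrow> x = h y"
      and h': "\<And>y. y \<in> Y \<Longrightarrow> (h has_derivative h' y) (at y)"
        "\<And>v. continuous_on Y (\<lambda>y. h' y v)"
    have root: "\<forall>\<^sub>F y in nhds 0. f (h y, y) = 0"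
      using eventually_nhds_in_open[OF XY(3,4)] by eventually_elim (use zero XY(7) in auto)
    have inj_\<Lambda>: "u = 0" if "\<Lambda> (u, 0) = 0" for u
      using that inj by (simp add: \<Lambda>_def)
    have l_\<Lambda>: "\<Lambda> (l y, y) = 0" for y
      using l by (simp add: \<Lambda>_def)
    obtain M where "\<forall>\<^sub>F y in nhds 0. norm (h y - l y) \<le> M * (norm y)\<^sup>2"
      by (rule implicit_function_leading_order[OF \<Lambda> rem_f inj_\<Lambda> h'(1)[OF XY(4)] XY(6) root l_\<Lambda>])
    then show thesis
      using XY(1-4,6) zero h' subsetD[OF XY(5)]
      by (intro that[of X Y h h' M]) (auto simp: f_def)
  qed assumption
qed

text \<open>The curve is the image of a line through 0. Its smoothness comes from
  \<open>\<gamma>'\<close> on \<open>Y\<close>, its tangent vector from the explicit derivative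
  \<open>l\<close> at 0.\<close>

lemma curve_tangent_to_ray_along_line:
  fixes \<gamma> :: "'b::real_normed_vector \<Rightarrow> 'a::real_normed_vector"
  assumes "0 < \<epsilon>" and Y: "\<And>s. \<bar>s\<bar> < \<epsilon> \<Longrightarrow> s *\<^sub>R e \<in> Y"
    and der: "\<And>y. y \<in> Y \<Longrightarrow> (\<gamma> has_derivative \<gamma>' y) (at y)"
    and cont: "continuous_on Y (\<lambda>y. \<gamma>' y e)"
    and "\<gamma> 0 = 0" and l: "(\<gamma> has_derivative l) (at 0)" "l e \<noteq> 0" "l e \<in> L"
    and "B = V \<inter> (\<lambda>s. \<gamma> (s *\<^sub>R e)) ` {0 <..< \<epsilon>}"
  shows "curve_tangent_to_ray V B L"
proof -
  let ?g = "\<lambda>s. \<gamma> (s *\<^sub>R e)"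
  have line: "((\<lambda>s. s *\<^sub>R e) has_vector_derivative e) (at s)" for s
    by (auto intro!: derivative_eq_intros)
  have vd: "(?g has_vector_derivative D e) (at s)"
    if "(\<gamma> has_derivative D) (at (s *\<^sub>R e))" for s D
    using vector_derivative_diff_chain_within[OF line[of s] has_derivative_at_withinI[OF that]]
    by (simp add: o_def)
  have D: "continuous_on {-\<epsilon> <..< \<epsilon>} (\<lambda>s. \<gamma>' (s *\<^sub>R e) e)"
    by (rule continuous_on_compose2[OF cont]) (auto intro!: continuous_intros Y)
  have "(?g has_vector_derivative \<gamma>' (s *\<^sub>R e) e) (at s)" if "s \<in> {-\<epsilon> <..< \<epsilon>}" for s
    using that by (intro vd der Y) auto
  then have "?g C1_differentiable_on {-\<epsilon> <..< \<epsilon>}"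
    unfolding C1_differentiable_on_def
    by (intro exI[of _ "\<lambda>s. \<gamma>' (s *\<^sub>R e) e"] conjI ballI D)
  moreover have "(?g has_vector_derivative l e) (at 0)"
    using l(1) by (intro vd) simp
  ultimately show ?thesis
    unfolding curve_tangent_to_ray_def using assms
    by (intro exI[of _ ?g] exI[of _ "l e"] exI[of _ \<epsilon>]) auto
qed

text \<open>Sorting by which amplitudes vanish cancels the factors \<open>r\<close> and
  \<open>\<rho>\<close> and leaves the roots of the brackets. These roots may have either sign, and
  only positive ones are squares of positive amplitudes.\<close>

lemma amplitude_equilibria:
  fixes f g :: "real \<Rightarrow> real \<Rightarrow> real" and a b p q :: real
  assumes "0 < \<epsilon>" and bound: "\<bar>a\<bar> < \<epsilon>" "\<bar>b\<bar> < \<epsilon>" "\<bar>p\<bar> < \<epsilon>" "\<bar>q\<bar> < \<epsilon>"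
    and a: "\<And>R. \<bar>R\<bar> < \<epsilon> \<Longrightarrow> f R 0 = 0 \<longleftrightarrow> R = a"
    and b: "\<And>S. \<bar>S\<bar> < \<epsilon> \<Longrightarrow> g 0 S = 0 \<longleftrightarrow> S = b"
    and pq: "\<And>R S. \<bar>R\<bar> < \<epsilon> \<Longrightarrow> \<bar>S\<bar> < \<epsilon> \<Longrightarrow> f R S = 0 \<and> g R S = 0 \<longleftrightarrow> R = p \<and> S = q"
  shows "{(r, \<rho>). (r\<^sup>2 < \<epsilon> \<and> \<rho>\<^sup>2 < \<epsilon>) \<and> 0 \<le> r \<and> 0 \<le> \<rho> \<and> r * f (r\<^sup>2) (\<rho>\<^sup>2) = 0 \<and> \<rho> * g (r\<^sup>2) (\<rho>\<^sup>2) = 0} =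
    {(0, 0)} \<union> (if 0 < a then {(sqrt a, 0)} else {}) \<union> (if 0 < b then {(0, sqrt b)} else {}) \<union>
      (if 0 < p \<and> 0 < q then {(sqrt p, sqrt q)} else {})" (is "?L = ?R")
proof (intro set_eqI iffI)
  fix x assume "x \<in> ?L"
  then obtain r \<rho> where x: "x = (r, \<rho>)" and r: "r\<^sup>2 < \<epsilon>" "\<rho>\<^sup>2 < \<epsilon>" "0 \<le> r" "0 \<le> \<rho>"
    and eq: "r = 0 \<or> f (r\<^sup>2) (\<rho>\<^sup>2) = 0" "\<rho> = 0 \<or> g (r\<^sup>2) (\<rho>\<^sup>2) = 0" by auto
  have sq: "\<bar>r\<^sup>2\<bar> < \<epsilon>" "\<bar>\<rho>\<^sup>2\<bar> < \<epsilon>" using r by auto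
  consider "r = 0" "\<rho> = 0" | "r > 0" "\<rho> = 0" | "r = 0" "\<rho> > 0" | "r > 0" "\<rho> > 0"
    using r by linarith
  then show "x \<in> ?R"
  proof cases
    case 2
    then have "a = r\<^sup>2" using eq a[OF sq(1)] by simp
    then show ?thesis using 2 x by simp
  next
    case 3
    then have "b = \<rho>\<^sup>2" using eq b[OF sq(2)] by simp
    then show ?thesis using 3 x by simp
  next
    case 4
    then have "p = r\<^sup>2" "q = \<rho>\<^sup>2" using eq pq[OF sq] by simp_all
    then show ?thesis using 4 x by simp
  qed (simp add: x)
next
  fix x assume "x \<in> ?R"
  then consider "x = (0, 0)" | "0 < a" "x = (sqrt a, 0)" | "0 < b" "x = (0, sqrt b)"
    | "0 < p" "0 < q" "x = (sqrt p, sqrt q)"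
    by (auto split: if_splits)
  then show "x \<in> ?L"
    using a[OF bound(1)] b[OF bound(2)] pq[OF bound(3,4)] bound \<open>0 < \<epsilon>\<close> by cases auto
qed

lemma real_bigo_norm_power2:
  fixes f :: "'a::real_normed_vector \<Rightarrow> real"
  assumes "\<forall>\<^sub>F x in nhds 0. norm (h x) \<le> M * (norm x)\<^sup>2" "\<And>x. \<bar>f x\<bar> \<le> norm (h x)"
  shows "f \<in> O[nhds 0](\<lambda>x. (norm x)\<^sup>2)"
proof (rule bigoI)
  show "\<forall>\<^sub>F x in nhds 0. norm (f x) \<le> M * norm ((norm x)\<^sup>2)"
    using assms(1)
    by eventually_elim (simp, meson assms(2) order_trans)
qed

theorem mainTheorem7:
  fixes c d \<phi>301 \<phi>210 \<Delta>2 \<omega>0 :: real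
    and F G \<Theta> \<Phi> :: "real \<times> real \<times> real \<times> real \<Rightarrow> real"
    and W :: "(real \<times> real \<times> real \<times> real) set"
  assumes "\<phi>301 \<noteq> 0" and "\<phi>210 \<noteq> 0"
    and "\<Delta>2 = 1/8 * \<phi>210 * \<phi>301 - c * d" and "\<Delta>2 \<noteq> 0"
    and "\<omega>0 > 0"
    and "open W" and "0 \<in> W" and "smooth_on W F" and "smooth_on W G"
    and "(\<lambda>(R, S, \<alpha>2, \<alpha>3). F (R, S, \<alpha>2, \<alpha>3) - (\<alpha>3 + c * S + \<phi>301 * R))
           \<in> O[nhds 0](\<lambda>x. (norm x)\<^sup>2)"
    and "(\<lambda>(R, S, \<alpha>2, \<alpha>3). G (R, S, \<alpha>2, \<alpha>3) - (1/2 * \<alpha>2 + 1/8 * \<phi>210 * S + d * R))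
           \<in> O[nhds 0](\<lambda>x. (norm x)\<^sup>2)"
    and "(\<Theta> \<longlongrightarrow> 1) (at 0 within {(r, \<rho>, \<alpha>2, \<alpha>3). 0 \<le> r \<and> 0 \<le> \<rho>})"
    and "(\<Phi> \<longlongrightarrow> \<omega>0) (at 0 within {(r, \<rho>, \<alpha>2, \<alpha>3). 0 \<le> r \<and> 0 \<le> \<rho>})"
  shows "\<exists>(U :: (real \<times> real) set) (V :: (real \<times> real) set) A B P Q.
    open U \<and> 0 \<in> U \<and> open V \<and> 0 \<in> V \<and>
    (\<forall>(r, \<rho>)\<in>U. \<forall>(\<alpha>2, \<alpha>3)\<in>V. (r\<^sup>2, \<rho>\<^sup>2, \<alpha>2, \<alpha>3) \<in> W) \<and>
    continuous_on V A \<and> continuous_on V B \<and> continuous_on V P \<and> continuous_on V Q \<and>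
    (\<lambda>(\<alpha>2, \<alpha>3). A (\<alpha>2, \<alpha>3) - (- \<alpha>3 / \<phi>301)) \<in> O[nhds 0](\<lambda>\<alpha>. (norm \<alpha>)\<^sup>2) \<and>
    (\<lambda>(\<alpha>2, \<alpha>3). B (\<alpha>2, \<alpha>3) - (- 4 * \<alpha>2 / \<phi>210)) \<in> O[nhds 0](\<lambda>\<alpha>. (norm \<alpha>)\<^sup>2) \<and>
    (\<lambda>(\<alpha>2, \<alpha>3). P (\<alpha>2, \<alpha>3) - (1/2 * \<alpha>2 * c - 1/8 * \<alpha>3 * \<phi>210) / \<Delta>2)
      \<in> O[nhds 0](\<lambda>\<alpha>. (norm \<alpha>)\<^sup>2) \<and>
    (\<lambda>(\<alpha>2, \<alpha>3). Q (\<alpha>2, \<alpha>3) - (\<alpha>3 * d - 1/2 * \<alpha>2 * \<phi>301) / \<Delta>2)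
      \<in> O[nhds 0](\<lambda>\<alpha>. (norm \<alpha>)\<^sup>2) \<and>
    (\<forall>\<alpha>\<in>V.
      {(r, \<rho>). (r, \<rho>) \<in> U \<and> 0 \<le> r \<and> 0 \<le> \<rho> \<and> amplitude_field F G \<alpha> (r, \<rho>) = (0, 0)} =
        {(0, 0)} \<union>
        (if 0 < A \<alpha> then {(sqrt (A \<alpha>), 0)} else {}) \<union>
        (if 0 < B \<alpha> then {(0, sqrt (B \<alpha>))} else {}) \<union>
        (if 0 < P \<alpha> \<and> 0 < Q \<alpha> then {(sqrt (P \<alpha>), sqrt (Q \<alpha>))} else {})) \<and>
    (\<forall>\<alpha>\<in>V.
      (0 < A \<alpha> \<longrightarrow> periodic_orbit (flow_field F G \<Theta> \<Phi> \<alpha>) (flow_domain W \<alpha>)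
        (sphere 0 (sqrt (A \<alpha>)) \<times> {0})) \<and>
      (0 < B \<alpha> \<longrightarrow> periodic_orbit (flow_field F G \<Theta> \<Phi> \<alpha>) (flow_domain W \<alpha>)
        ({0} \<times> sphere 0 (sqrt (B \<alpha>)))) \<and>
      (0 < P \<alpha> \<and> 0 < Q \<alpha> \<longrightarrow> two_frequency_torus (flow_field F G \<Theta> \<Phi> \<alpha>) (flow_domain W \<alpha>)
        (sphere 0 (sqrt (P \<alpha>)) \<times> sphere 0 (sqrt (Q \<alpha>))))) \<and>
    curve_tangent_to_ray V
      {\<alpha>\<in>V. bifurcates_from
        {\<alpha>\<in>V. 0 < P \<alpha> \<and> 0 < Q \<alpha>} (\<lambda>\<alpha>. (sqrt (P \<alpha>), sqrt (Q \<alpha>)))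
        {\<alpha>\<in>V. 0 < A \<alpha>} (\<lambda>\<alpha>. (sqrt (A \<alpha>), 0)) \<alpha>}
      {(\<alpha>2, \<alpha>3). \<alpha>3 * d = 1/2 * \<alpha>2 * \<phi>301 \<and> 0 < - \<alpha>3 / \<phi>301} \<and>
    curve_tangent_to_ray V
      {\<alpha>\<in>V. bifurcates_from
        {\<alpha>\<in>V. 0 < P \<alpha> \<and> 0 < Q \<alpha>} (\<lambda>\<alpha>. (sqrt (P \<alpha>), sqrt (Q \<alpha>)))
        {\<alpha>\<in>V. 0 < B \<alpha>} (\<lambda>\<alpha>. (0, sqrt (B \<alpha>))) \<alpha>}
      {(\<alpha>2, \<alpha>3). \<alpha>2 * c = 1/4 * \<alpha>3 * \<phi>210 \<and> 0 < - 4 * \<alpha>2 / \<phi>210}"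
proof -

  \<comment> \<open>The two brackets as one map with linear part\<close>
  define H where "H x = (F x, G x)" for x
  define H' where "H' x v = (frechet_derivative F (at x) v, frechet_derivative G (at x) v)" for x v
  define L where "L x = (snd (snd (snd x)) + c * fst (snd x) + \<phi>301 * fst x,
      1/2 * fst (snd (snd x)) + 1/8 * \<phi>210 * fst (snd x) + d * fst x)" for x :: "real \<times> real \<times> real \<times> real"
  have derH: "(H has_derivative H' x) (at x)" if "x \<in> W" for x
    unfolding H_def H'_def using smooth_on_imp_C1(1)[OF assms(8) that] smooth_on_imp_C1(1)[OF assms(9) that]
    by (rule has_derivative_Pair)
  have contH: "continuous_on W (\<lambda>x. H' x v)" for v
    unfolding H'_def using smooth_on_imp_C1(2)[OF assms(8)] smooth_on_imp_C1(2)[OF assms(9)]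
    by (rule continuous_on_Pair)
  have linL: "bounded_linear L"
    unfolding L_def by (auto simp: linear_conv_bounded_linear[symmetric] linear_iff algebra_simps add_divide_distrib)
  obtain C1 where C1: "\<forall>\<^sub>F x in nhds 0. norm (F x - fst (L x)) \<le> C1 * norm ((norm x)\<^sup>2)"
    using assms(10) by (auto simp: case_prod_unfold L_def elim!: landau_o.bigE)
  obtain C2 where C2: "\<forall>\<^sub>F x in nhds 0. norm (G x - snd (L x)) \<le> C2 * norm ((norm x)\<^sup>2)"
    using assms(11) by (auto simp: case_prod_unfold L_def elim!: landau_o.bigE)
  have rem: "\<forall>\<^sub>F x in nhds 0. norm (H x - L x) \<le> (C1 + C2) * (norm x)\<^sup>2"
    using C1 C2
  proof eventually_elim
    case (elim x)
    have "H x - L x = (F x - fst (L x), G x - snd (L x))"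
      by (simp add: H_def prod_eq_iff)
    then have "norm (H x - L x) \<le> norm (F x - fst (L x)) + norm (G x - snd (L x))"
      using norm_Pair_le by metis
    with elim show ?case by (simp add: distrib_right)
  qed
  note branch = implicit_solution_branch[OF assms(6,7) derH contH linL rem]

  \<comment> \<open>The three solution branches and the parameters as functions of the squared
    amplitudes\<close>
  define JA where "JA p = (fst p, 0 :: real, snd p)" for p :: "real \<times> real \<times> real"
  define JB where "JB p = (0 :: real, fst p, snd p)" for p :: "real \<times> real \<times> real"
  define JP where "JP p = (fst (fst p), snd (fst p), snd p)" for p :: "(real \<times> real) \<times> real \<times> real"
  \<comment> \<open>Here the roles are reversed: the parameters are the unknowns, and the squared
    amplitudes are given.\<close>
  define JG where "JG p = (fst (snd p), snd (snd p), fst p)" for p :: "(real \<times> real) \<times> real \<times> real"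
  note J_defs = JA_def JB_def JP_def JG_def
  \<comment> \<open>These are the solutions of the linearised equations: \<open>lA\<close>,
    \<open>lB\<close>, \<open>lP\<close> give the displayed leading-order squared amplitudes, and
    \<open>lG\<close> solves for the parameters.\<close>
  define lA where "lA \<alpha> = - snd \<alpha> / \<phi>301" for \<alpha> :: "real \<times> real"
  define lB where "lB \<alpha> = - 4 * fst \<alpha> / \<phi>210" for \<alpha> :: "real \<times> real"
  define lP where "lP \<alpha> = ((1/2 * fst \<alpha> * c - 1/8 * snd \<alpha> * \<phi>210) / \<Delta>2,
      (snd \<alpha> * d - 1/2 * fst \<alpha> * \<phi>301) / \<Delta>2)" for \<alpha> :: "real \<times> real"
  define lG where "lG y = (- 1/4 * \<phi>210 * snd y - 2 * d * fst y, - c * snd y - \<phi>301 * fst y)"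
    for y :: "real \<times> real"
  have bl: "bounded_linear JA" "bounded_linear JB" "bounded_linear JP" "bounded_linear JG" "bounded_linear lG"
    unfolding J_defs lG_def by (auto simp: linear_conv_bounded_linear[symmetric] linear_iff algebra_simps add_divide_distrib)

  have injA: "u = 0" if "fst (L (JA (u, 0))) = 0" for u
    using that assms(1) by (simp add: JA_def L_def)
  have zeroA: "fst (L (JA (lA y, y))) = 0" for y
    using assms(1) by (simp add: JA_def L_def lA_def)
  obtain XA YA A A' MA where XA: "open XA" "0 \<in> XA" and YA: "open YA" "0 \<in> YA" and A0: "A 0 = 0"
    and "\<And>x y. x \<in> XA \<Longrightarrow> y \<in> YA \<Longrightarrow> JA (x, y) \<in> W"
    and A: "\<And>x y. x \<in> XA \<Longrightarrow> y \<in> YA \<Longrightarrow> fst (H (JA (x, y))) = 0 \<longleftrightarrow> x = A y"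
    and derA: "\<And>y. y \<in> YA \<Longrightarrow> (A has_derivative A' y) (at y)"
    and "\<And>v. continuous_on YA (\<lambda>y. A' y v)"
    and MA: "\<forall>\<^sub>F y in nhds 0. norm (A y - lA y) \<le> MA * (norm y)\<^sup>2"
    by (rule branch[OF _ bl(1) bounded_linear_fst injA zeroA], assumption+) (rule that; (assumption | blast | simp))

  have injB: "u = 0" if "snd (L (JB (u, 0))) = 0" for u
    using that assms(2) by (simp add: JB_def L_def)
  have zeroB: "snd (L (JB (lB y, y))) = 0" for y
    using assms(2) by (simp add: JB_def L_def lB_def)
  obtain XB YB B B' MB where XB: "open XB" "0 \<in> XB" and YB: "open YB" "0 \<in> YB" and B0: "B 0 = 0"
    and "\<And>x y. x \<in> XB \<Longrightarrow> y \<in> YB \<Longrightarrow> JB (x, y) \<in> W"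
    and B: "\<And>x y. x \<in> XB \<Longrightarrow> y \<in> YB \<Longrightarrow> snd (H (JB (x, y))) = 0 \<longleftrightarrow> x = B y"
    and derB: "\<And>y. y \<in> YB \<Longrightarrow> (B has_derivative B' y) (at y)"
    and "\<And>v. continuous_on YB (\<lambda>y. B' y v)"
    and MB: "\<forall>\<^sub>F y in nhds 0. norm (B y - lB y) \<le> MB * (norm y)\<^sup>2"
    by (rule branch[OF _ bl(2) bounded_linear_snd injB zeroB], assumption+) (rule that; (assumption | blast | simp))

  have injP: "u = 0" if "L (JP (u, 0)) = 0" for u
  proof -
    have 1: "c * snd u + \<phi>301 * fst u = 0" and 2: "1/8 * \<phi>210 * snd u + d * fst u = 0"
      using that by (simp_all add: JP_def L_def prod_eq_iff)
    \<comment> \<open>Cramer's rule: \<open>\<Delta>2\<close> is the determinant of the linear part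
      in \<open>(R, S)\<close>.\<close>
    have "\<Delta>2 * fst u = 1/8 * \<phi>210 * (c * snd u + \<phi>301 * fst u) - c * (1/8 * \<phi>210 * snd u + d * fst u)"
      and "\<Delta>2 * snd u = \<phi>301 * (1/8 * \<phi>210 * snd u + d * fst u) - d * (c * snd u + \<phi>301 * fst u)"
      unfolding assms(3) by (simp_all add: algebra_simps)
    then show "u = 0"
      unfolding 1 2 using assms(4) by (simp add: prod_eq_iff)
  qed
  have zeroP: "L (JP (lP y, y)) = 0" for y
  proof -
    obtain a b where y: "y = (a, b)" by force
    \<comment> \<open>Over the common denominator the numerators vanish as polynomial identities
      once \<open>\<Delta>2\<close> is expanded.\<close>
    have "b + c * ((b * d - 1/2 * a * \<phi>301) / \<Delta>2) + \<phi>301 * ((1/2 * a * c - 1/8 * b * \<phi>210) / \<Delta>2) =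
        (b * \<Delta>2 + c * (b * d - 1/2 * a * \<phi>301) + \<phi>301 * (1/2 * a * c - 1/8 * b * \<phi>210)) / \<Delta>2"
      and "1/2 * a + 1/8 * \<phi>210 * ((b * d - 1/2 * a * \<phi>301) / \<Delta>2) + d * ((1/2 * a * c - 1/8 * b * \<phi>210) / \<Delta>2) =
        (1/2 * a * \<Delta>2 + 1/8 * \<phi>210 * (b * d - 1/2 * a * \<phi>301) + d * (1/2 * a * c - 1/8 * b * \<phi>210)) / \<Delta>2"
      using assms(4) by (simp_all add: field_simps)
    moreover have "b * \<Delta>2 + c * (b * d - 1/2 * a * \<phi>301) + \<phi>301 * (1/2 * a * c - 1/8 * b * \<phi>210) = 0"
      and "1/2 * a * \<Delta>2 + 1/8 * \<phi>210 * (b * d - 1/2 * a * \<phi>301) + d * (1/2 * a * c - 1/8 * b * \<phi>210) = 0"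
      unfolding assms(3) by (simp_all add: algebra_simps)
    ultimately show ?thesis
      unfolding y L_def JP_def lP_def fst_conv snd_conv by (simp only: div_0 zero_prod_def)
  qed
  obtain XP YP PQ PQ' MP where XP: "open XP" "0 \<in> XP" and YP: "open YP" "0 \<in> YP" and PQ0: "PQ 0 = 0"
    and inW: "\<And>x y. x \<in> XP \<Longrightarrow> y \<in> YP \<Longrightarrow> JP (x, y) \<in> W"
    and PQ: "\<And>x y. x \<in> XP \<Longrightarrow> y \<in> YP \<Longrightarrow> H (JP (x, y)) = 0 \<longleftrightarrow> x = PQ y"
    and derPQ: "\<And>y. y \<in> YP \<Longrightarrow> (PQ has_derivative PQ' y) (at y)"
    and "\<And>v. continuous_on YP (\<lambda>y. PQ' y v)"
    and MP: "\<forall>\<^sub>F y in nhds 0. norm (PQ y - lP y) \<le> MP * (norm y)\<^sup>2"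
    by (rule branch[OF _ bl(3) bounded_linear_ident injP zeroP], assumption+) (rule that; (assumption | blast | simp))

  \<comment> \<open>Each parameter occurs in just one linear part, with coefficient 1 or 1/2, so the
    system is diagonal up to order.\<close>
  have injG: "u = 0" if "L (JG (u, 0)) = 0" for u
    using that by (simp add: JG_def L_def prod_eq_iff)
  have zeroG: "L (JG (lG y, y)) = 0" for y
    by (simp add: JG_def L_def lG_def prod_eq_iff algebra_simps)
  obtain XG YG \<gamma> \<gamma>' MG where XG: "open XG" "0 \<in> XG" and YG: "open YG" "0 \<in> YG" and \<gamma>0: "\<gamma> 0 = 0"
    and "\<And>x y. x \<in> XG \<Longrightarrow> y \<in> YG \<Longrightarrow> JG (x, y) \<in> W"
    and \<gamma>: "\<And>x y. x \<in> XG \<Longrightarrow> y \<in> YG \<Longrightarrow> H (JG (x, y)) = 0 \<longleftrightarrow> x = \<gamma> y"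
    and der\<gamma>: "\<And>y. y \<in> YG \<Longrightarrow> (\<gamma> has_derivative \<gamma>' y) (at y)"
    and cont\<gamma>': "\<And>v. continuous_on YG (\<lambda>y. \<gamma>' y v)"
    and MG: "\<forall>\<^sub>F y in nhds 0. norm (\<gamma> y - lG y) \<le> MG * (norm y)\<^sup>2"
    by (rule branch[OF _ bl(4) bounded_linear_ident injG zeroG], assumption+) (rule that; (assumption | blast | simp))
  have der\<gamma>0: "(\<gamma> has_derivative lG) (at 0)"
    by (rule has_derivative_quadratic_remainder(2)[OF bl(5) MG])

  \<comment> \<open>Choice of the neighbourhoods\<close>
  have "\<forall>\<^sub>F x in at 0 within {(r, \<rho>, \<alpha>2, \<alpha>3). 0 \<le> r \<and> 0 \<le> \<rho>}. 0 < \<Theta> x \<and> 0 < \<Phi> x"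
    using order_tendstoD(1)[OF assms(12), of 0] order_tendstoD(1)[OF assms(13), of 0] assms(5)
    by (intro eventually_conj) simp_all
  \<comment> \<open>The limits say nothing about the values at 0 itself; every nontrivial family has
    a positive amplitude and avoids that point.\<close>
  then obtain \<eta> where \<eta>: "\<eta> > 0" and phase0:
    "\<And>x. 0 \<le> fst x \<Longrightarrow> 0 \<le> fst (snd x) \<Longrightarrow> x \<noteq> 0 \<Longrightarrow> norm x < \<eta> \<Longrightarrow> 0 < \<Theta> x \<and> 0 < \<Phi> x"
    unfolding eventually_at by (auto simp: case_prod_unfold)

  have "\<forall>\<^sub>F p in nhds 0. p \<in> XP \<and> p \<in> YG \<and> p \<in> XA \<times> UNIV \<and> p \<in> UNIV \<times> XB"
    using XP YG XA XB
    by (intro eventually_conj eventually_nhds_in_open open_Times) (auto simp: zero_prod_def)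
  then obtain \<delta> where \<delta>: "\<delta> > 0" and box0:
    "\<And>p. norm p < \<delta> \<Longrightarrow> p \<in> XP \<and> p \<in> YG \<and> fst p \<in> XA \<and> snd p \<in> XB"
    unfolding eventually_nhds_metric by (auto simp: mem_Times_iff)
  \<comment> \<open>The first bound puts \<open>(R, S)\<close> within \<open>\<delta>\<close> of 0.
    The second keeps each amplitude below \<open>\<eta> / 4\<close>; with
    \<open>norm \<alpha> < \<eta> / 4\<close> the three contributions stay below
    \<open>\<eta>\<close>.\<close>
  define \<epsilon> where "\<epsilon> = min (\<delta> / 2) ((\<eta> / 4)\<^sup>2)"
  have \<epsilon>: "0 < \<epsilon>" using \<delta> \<eta> by (simp add: \<epsilon>_def)
  have box: "(R, S) \<in> XP" "(R, S) \<in> YG" "R \<in> XA" "S \<in> XB" if "\<bar>R\<bar> < \<epsilon>" "\<bar>S\<bar> < \<epsilon>" for R S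
  proof -
    have "norm (R, S) < \<delta>"
      using norm_Pair_le[of R S] that by (simp add: \<epsilon>_def)
    from box0[OF this] show "(R, S) \<in> XP" "(R, S) \<in> YG" "R \<in> XA" "S \<in> XB" by auto
  qed

  define P where "P \<alpha> = fst (PQ \<alpha>)" for \<alpha>
  define Q where "Q \<alpha> = snd (PQ \<alpha>)" for \<alpha>
  have lim0: "\<forall>\<^sub>F \<alpha> in nhds 0. \<bar>f \<alpha>\<bar> < \<epsilon>" if "isCont f 0" "f 0 = 0" for f :: "real \<times> real \<Rightarrow> real"
  proof -
    have "(f \<longlongrightarrow> 0) (nhds 0)"
      using that tendsto_at_iff_tendsto_nhds[of f 0] by (simp add: isCont_def)
    from tendstoD[OF this \<epsilon>] show ?thesis by simp
  qed
  have "isCont A 0" "isCont B 0" "isCont P 0" "isCont Q 0"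
    unfolding P_def Q_def
    using has_derivative_continuous[OF derA[OF YA(2)]] has_derivative_continuous[OF derB[OF YB(2)]]
      has_derivative_continuous[OF derPQ[OF YP(2)]]
    by (auto intro: continuous_intros)
  then have "\<forall>\<^sub>F \<alpha> in nhds 0. \<alpha> \<in> YA \<and> \<alpha> \<in> YB \<and> \<alpha> \<in> YP \<and> \<alpha> \<in> XG \<and> \<alpha> \<in> ball 0 (\<eta> / 4) \<and>
      \<bar>A \<alpha>\<bar> < \<epsilon> \<and> \<bar>B \<alpha>\<bar> < \<epsilon> \<and> \<bar>P \<alpha>\<bar> < \<epsilon> \<and> \<bar>Q \<alpha>\<bar> < \<epsilon>"
    using YA YB YP XG \<eta> A0 B0 PQ0 P_def[of 0] Q_def[of 0]
    by (intro eventually_conj eventually_nhds_in_open lim0) auto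
  then obtain V where V: "open V" "0 \<in> V" and V': "\<And>\<alpha>. \<alpha> \<in> V \<Longrightarrow> \<alpha> \<in> YA \<and> \<alpha> \<in> YB \<and> \<alpha> \<in> YP \<and> \<alpha> \<in> XG \<and>
      norm \<alpha> < \<eta> / 4"
    and bound: "\<And>\<alpha>. \<alpha> \<in> V \<Longrightarrow> \<bar>A \<alpha>\<bar> < \<epsilon>" "\<And>\<alpha>. \<alpha> \<in> V \<Longrightarrow> \<bar>B \<alpha>\<bar> < \<epsilon>"
      "\<And>\<alpha>. \<alpha> \<in> V \<Longrightarrow> \<bar>P \<alpha>\<bar> < \<epsilon>" "\<And>\<alpha>. \<alpha> \<in> V \<Longrightarrow> \<bar>Q \<alpha>\<bar> < \<epsilon>"
    unfolding eventually_nhds by (auto simp: dist_norm)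

  \<comment> \<open>Zeros of the brackets and equilibria on a common box\<close>
  have FA: "F (R, 0, \<alpha>) = 0 \<longleftrightarrow> R = A \<alpha>" if "\<alpha> \<in> V" "\<bar>R\<bar> < \<epsilon>" for \<alpha> R
    using A[of R \<alpha>] box(3)[of R 0] V'[OF that(1)] that \<epsilon> by (simp add: H_def JA_def)
  have GB: "G (0, S, \<alpha>) = 0 \<longleftrightarrow> S = B \<alpha>" if "\<alpha> \<in> V" "\<bar>S\<bar> < \<epsilon>" for \<alpha> S
    using B[of S \<alpha>] box(4)[of 0 S] V'[OF that(1)] that \<epsilon> by (simp add: H_def JB_def)
  have FGP: "F (R, S, \<alpha>) = 0 \<and> G (R, S, \<alpha>) = 0 \<longleftrightarrow> R = P \<alpha> \<and> S = Q \<alpha>"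
    if "\<alpha> \<in> V" "\<bar>R\<bar> < \<epsilon>" "\<bar>S\<bar> < \<epsilon>" for \<alpha> R S
    using PQ[of "(R, S)" \<alpha>] box(1)[of R S] V'[OF that(1)] that
    by (simp add: H_def JP_def P_def Q_def prod_eq_iff)
  \<comment> \<open>A second description of the zero set of \<open>FGP\<close>; comparing the two
    shows that \<open>\<gamma>\<close> inverts \<open>(P, Q)\<close> locally.\<close>
  have FG\<gamma>: "F (R, S, \<alpha>) = 0 \<and> G (R, S, \<alpha>) = 0 \<longleftrightarrow> \<alpha> = \<gamma> (R, S)"
    if "\<alpha> \<in> V" "\<bar>R\<bar> < \<epsilon>" "\<bar>S\<bar> < \<epsilon>" for \<alpha> R S
    using \<gamma>[of \<alpha> "(R, S)"] box(2)[of R S] V'[OF that(1)] that by (simp add: H_def JG_def zero_prod_def)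
  have W: "(R, S, \<alpha>) \<in> W" if "\<alpha> \<in> V" "\<bar>R\<bar> < \<epsilon>" "\<bar>S\<bar> < \<epsilon>" for \<alpha> R S
    using inW[of "(R, S)" \<alpha>] box(1)[of R S] V'[OF that(1)] that by (simp add: JP_def)
  have contV: "continuous_on V A" "continuous_on V B" "continuous_on V P" "continuous_on V Q"
  proof -
    have "continuous_on V A" "continuous_on V B" "continuous_on V PQ"
      using V' derA derB derPQ
      by (meson continuous_at_imp_continuous_on has_derivative_continuous)+
    then show "continuous_on V A" "continuous_on V B" "continuous_on V P" "continuous_on V Q"
      unfolding P_def Q_def by (auto intro: continuous_intros)
  qed
  have phase: "0 < \<Theta> (r, \<rho>, \<alpha>) \<and> 0 < \<Phi> (r, \<rho>, \<alpha>)"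
    if "\<alpha> \<in> V" "0 \<le> r" "0 \<le> \<rho>" "0 < r \<or> 0 < \<rho>" "r\<^sup>2 < \<epsilon>" "\<rho>\<^sup>2 < \<epsilon>" for \<alpha> r \<rho>
  proof (rule phase0)
    have "r < \<eta> / 4" "\<rho> < \<eta> / 4"
      by (rule power2_less_imp_less; use that \<eta> in \<open>simp add: \<epsilon>_def\<close>)+
    then show "norm (r, \<rho>, \<alpha>) < \<eta>"
      using norm_Pair_le[of r "(\<rho>, \<alpha>)"] norm_Pair_le[of \<rho> \<alpha>] V'[OF that(1)] that(2,3) \<eta> by simp
  qed (use that in \<open>auto simp: zero_prod_def\<close>)

  define U where "U = {(r, \<rho>). r\<^sup>2 < \<epsilon> \<and> \<rho>\<^sup>2 < \<epsilon>}"
  have openU: "open U"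
    unfolding U_def case_prod_unfold by (intro open_Collect_conj open_Collect_less continuous_intros)
  have field: "amplitude_field F G \<alpha> (r, \<rho>) = (r * F (r\<^sup>2, \<rho>\<^sup>2, \<alpha>), \<rho> * G (r\<^sup>2, \<rho>\<^sup>2, \<alpha>))" for \<alpha> r \<rho>
    by (cases \<alpha>) simp
  have equilibria: "{(r, \<rho>). (r, \<rho>) \<in> U \<and> 0 \<le> r \<and> 0 \<le> \<rho> \<and> amplitude_field F G \<alpha> (r, \<rho>) = (0, 0)} =
        {(0, 0)} \<union>
        (if 0 < A \<alpha> then {(sqrt (A \<alpha>), 0)} else {}) \<union>
        (if 0 < B \<alpha> then {(0, sqrt (B \<alpha>))} else {}) \<union>
        (if 0 < P \<alpha> \<and> 0 < Q \<alpha> then {(sqrt (P \<alpha>), sqrt (Q \<alpha>))} else {})" if \<alpha>: "\<alpha> \<in> V" for \<alpha>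
    using amplitude_equilibria[OF \<epsilon> bound[OF \<alpha>], of "\<lambda>R S. F (R, S, \<alpha>)" "\<lambda>R S. G (R, S, \<alpha>)",
        OF FA[OF \<alpha>] GB[OF \<alpha>] FGP[OF \<alpha>]]
    unfolding field U_def by simp

  \<comment> \<open>Periodic orbits and invariant tori\<close>
  have orbitA: "periodic_orbit (flow_field F G \<Theta> \<Phi> \<alpha>) (flow_domain W \<alpha>) (sphere 0 (sqrt (A \<alpha>)) \<times> {0})"
    if \<alpha>: "\<alpha> \<in> V" "0 < A \<alpha>" for \<alpha>
    using that W[OF \<alpha>(1), of "A \<alpha>" 0] FA[OF \<alpha>(1), of "A \<alpha>"] bound(1)[OF \<alpha>(1)] \<epsilon>
      phase[OF \<alpha>(1), of "sqrt (A \<alpha>)" 0]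
    by (intro periodic_orbit_axis1) simp_all
  have orbitB: "periodic_orbit (flow_field F G \<Theta> \<Phi> \<alpha>) (flow_domain W \<alpha>) ({0} \<times> sphere 0 (sqrt (B \<alpha>)))"
    if \<alpha>: "\<alpha> \<in> V" "0 < B \<alpha>" for \<alpha>
    using that W[OF \<alpha>(1), of 0 "B \<alpha>"] GB[OF \<alpha>(1), of "B \<alpha>"] bound(2)[OF \<alpha>(1)] \<epsilon>
      phase[OF \<alpha>(1), of 0 "sqrt (B \<alpha>)"]
    by (intro periodic_orbit_axis2) simp_all
  have torus: "two_frequency_torus (flow_field F G \<Theta> \<Phi> \<alpha>) (flow_domain W \<alpha>)
      (sphere 0 (sqrt (P \<alpha>)) \<times> sphere 0 (sqrt (Q \<alpha>)))"
    if \<alpha>: "\<alpha> \<in> V" "0 < P \<alpha>" "0 < Q \<alpha>" for \<alpha>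
  proof -
    have PQW: "(P \<alpha>, Q \<alpha>, \<alpha>) \<in> W"
      using W[OF \<alpha>(1) bound(3)[OF \<alpha>(1)] bound(4)[OF \<alpha>(1)]] .
    then have "F differentiable (at (P \<alpha>, Q \<alpha>, \<alpha>))" "G differentiable (at (P \<alpha>, Q \<alpha>, \<alpha>))"
      using smooth_on_imp_C1(1) assms(8,9) unfolding differentiable_def by blast+
    then show ?thesis
      using \<alpha> PQW FGP[OF \<alpha>(1) bound(3)[OF \<alpha>(1)] bound(4)[OF \<alpha>(1)]] bound(3,4)[OF \<alpha>(1)]
        phase[OF \<alpha>(1), of "sqrt (P \<alpha>)" "sqrt (Q \<alpha>)"]
      by (intro two_frequency_torus_equilibrium) simp_all
  qed

  \<comment> \<open>Bifurcation curves and their tangents\<close>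
  have box_eq: "y \<in> YG" if "y \<in> {- \<epsilon> <..< \<epsilon>} \<times> {- \<epsilon> <..< \<epsilon>}" for y
    using that box(2)[of "fst y" "snd y"] by (auto simp: mem_Times_iff abs_less_iff)
  have cont\<gamma>: "continuous_on ({- \<epsilon> <..< \<epsilon>} \<times> {- \<epsilon> <..< \<epsilon>}) \<gamma>"
    by (intro continuous_at_imp_continuous_on ballI has_derivative_continuous[OF der\<gamma>] box_eq)
  have bifA: "{\<alpha>\<in>V. bifurcates_from
        {\<alpha>\<in>V. 0 < P \<alpha> \<and> 0 < Q \<alpha>} (\<lambda>\<alpha>. (sqrt (P \<alpha>), sqrt (Q \<alpha>)))
        {\<alpha>\<in>V. 0 < A \<alpha>} (\<lambda>\<alpha>. (sqrt (A \<alpha>), 0)) \<alpha>} = V \<inter> (\<lambda>s. \<gamma> (s *\<^sub>R (1, 0))) ` {0 <..< \<epsilon>}"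
  proof -
    \<comment> \<open>If \<open>Q \<alpha> = 0\<close>, then \<open>(P \<alpha>, 0)\<close> is a
      zero of both brackets, and \<open>A \<alpha>\<close> is the only root of \<open>F\<close> on
      that axis.\<close>
    have "A \<alpha> = P \<alpha>" if "\<alpha> \<in> V" "Q \<alpha> = 0" for \<alpha>
      using FA[OF that(1) bound(3)[OF that(1)]] FGP[OF that(1) bound(3)[OF that(1)], of 0] that \<epsilon> by simp
    moreover have "\<alpha> = \<gamma> (R, S) \<longleftrightarrow> (R, S) = (P \<alpha>, Q \<alpha>)" if "\<alpha> \<in> V" "\<bar>R\<bar> < \<epsilon>" "\<bar>S\<bar> < \<epsilon>" for \<alpha> R S
      using FG\<gamma>[OF that] FGP[OF that] by auto
    ultimately show ?thesis
      using bifurcation_set[OF V(1) contV(1,3,4) _ _ cont\<gamma>] bound(3,4) by simp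
  qed
  have bifB: "{\<alpha>\<in>V. bifurcates_from
        {\<alpha>\<in>V. 0 < P \<alpha> \<and> 0 < Q \<alpha>} (\<lambda>\<alpha>. (sqrt (P \<alpha>), sqrt (Q \<alpha>)))
        {\<alpha>\<in>V. 0 < B \<alpha>} (\<lambda>\<alpha>. (0, sqrt (B \<alpha>))) \<alpha>} = V \<inter> (\<lambda>s. \<gamma> (s *\<^sub>R (0, 1))) ` {0 <..< \<epsilon>}"
  proof -
    have "B \<alpha> = Q \<alpha>" if "\<alpha> \<in> V" "P \<alpha> = 0" for \<alpha>
      using GB[OF that(1) bound(4)[OF that(1)]] FGP[OF that(1) _ bound(4)[OF that(1)], of 0] that \<epsilon> by simp
    \<comment> \<open>Composing with the swap lets the second half-axis play the part of the
      first.\<close>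
    moreover have "\<alpha> = (\<gamma> \<circ> prod.swap) (S, R) \<longleftrightarrow> (S, R) = (Q \<alpha>, P \<alpha>)"
      if "\<alpha> \<in> V" "\<bar>S\<bar> < \<epsilon>" "\<bar>R\<bar> < \<epsilon>" for \<alpha> R S
      using FG\<gamma>[OF that(1,3,2)] FGP[OF that(1,3,2)] by auto
    moreover have "continuous_on ({- \<epsilon> <..< \<epsilon>} \<times> {- \<epsilon> <..< \<epsilon>}) (\<gamma> \<circ> prod.swap)"
      by (intro continuous_on_compose continuous_on_swap) (simp add: product_swap cont\<gamma>)
    ultimately have "{\<alpha>\<in>V. bifurcates_from
        {\<alpha>\<in>V. 0 < Q \<alpha> \<and> 0 < P \<alpha>} (\<lambda>\<alpha>. (sqrt (Q \<alpha>), sqrt (P \<alpha>)))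
        {\<alpha>\<in>V. 0 < B \<alpha>} (\<lambda>\<alpha>. (sqrt (B \<alpha>), 0)) \<alpha>} = V \<inter> (\<lambda>s. (\<gamma> \<circ> prod.swap) (s, 0)) ` {0 <..< \<epsilon>}"
      using bound(3,4) by (intro bifurcation_set V(1) contV) simp_all
    then show ?thesis
      using bifurcates_from_swap[of "{\<alpha>\<in>V. 0 < P \<alpha> \<and> 0 < Q \<alpha>}" "\<lambda>\<alpha>. (sqrt (P \<alpha>), sqrt (Q \<alpha>))"
          "{\<alpha>\<in>V. 0 < B \<alpha>}" "\<lambda>\<alpha>. (0, sqrt (B \<alpha>))"]
      by (simp add: conj_commute)
  qed
  \<comment> \<open>The tangent vector is \<open>lG (1, 0) = (- 2 * d, - \<phi>301)\<close>, on
    which \<open>- \<alpha>3 / \<phi>301\<close> takes the value 1.\<close>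
  have curveA: "curve_tangent_to_ray V (V \<inter> (\<lambda>s. \<gamma> (s *\<^sub>R (1, 0))) ` {0 <..< \<epsilon>})
      {(\<alpha>2, \<alpha>3). \<alpha>3 * d = 1/2 * \<alpha>2 * \<phi>301 \<and> 0 < - \<alpha>3 / \<phi>301}"
    using \<epsilon> assms(1)
    by (intro curve_tangent_to_ray_along_line[where e = "(1, 0)", OF \<epsilon> _ der\<gamma> cont\<gamma>' \<gamma>0 der\<gamma>0])
      (auto simp: lG_def zero_prod_def intro: box(2))
  \<comment> \<open>The tangent vector is \<open>lG (0, 1) = (- \<phi>210 / 4, - c)\<close>, on
    which \<open>- 4 * \<alpha>2 / \<phi>210\<close> takes the value 1.\<close>
  have curveB: "curve_tangent_to_ray V (V \<inter> (\<lambda>s. \<gamma> (s *\<^sub>R (0, 1))) ` {0 <..< \<epsilon>})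
      {(\<alpha>2, \<alpha>3). \<alpha>2 * c = 1/4 * \<alpha>3 * \<phi>210 \<and> 0 < - 4 * \<alpha>2 / \<phi>210}"
    using \<epsilon> assms(2)
    by (intro curve_tangent_to_ray_along_line[where e = "(0, 1)", OF \<epsilon> _ der\<gamma> cont\<gamma>' \<gamma>0 der\<gamma>0])
      (auto simp: lG_def zero_prod_def intro: box(2))

  \<comment> \<open>Assembly of the conclusions\<close>
  show ?thesis
  proof (rule exI[of _ U], rule exI[of _ V], rule exI[of _ A], rule exI[of _ B], rule exI[of _ P],
      rule exI[of _ Q], intro conjI)
    show "open U" "0 \<in> U" "open V" "0 \<in> V"
      using openU V \<epsilon> by (auto simp: U_def zero_prod_def)
    show "\<forall>(r, \<rho>)\<in>U. \<forall>(\<alpha>2, \<alpha>3)\<in>V. (r\<^sup>2, \<rho>\<^sup>2, \<alpha>2, \<alpha>3) \<in> W"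
      using W by (auto simp: U_def)
    show "continuous_on V A" "continuous_on V B" "continuous_on V P" "continuous_on V Q"
      by (fact contV)+
    show "(\<lambda>(\<alpha>2, \<alpha>3). A (\<alpha>2, \<alpha>3) - (- \<alpha>3 / \<phi>301)) \<in> O[nhds 0](\<lambda>\<alpha>. (norm \<alpha>)\<^sup>2)"
      by (rule real_bigo_norm_power2[OF MA]) (simp add: lA_def case_prod_unfold)
    show "(\<lambda>(\<alpha>2, \<alpha>3). B (\<alpha>2, \<alpha>3) - (- 4 * \<alpha>2 / \<phi>210)) \<in> O[nhds 0](\<lambda>\<alpha>. (norm \<alpha>)\<^sup>2)"
      by (rule real_bigo_norm_power2[OF MB]) (simp add: lB_def case_prod_unfold)
    show "(\<lambda>(\<alpha>2, \<alpha>3). P (\<alpha>2, \<alpha>3) - (1/2 * \<alpha>2 * c - 1/8 * \<alpha>3 * \<phi>210) / \<Delta>2)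
        \<in> O[nhds 0](\<lambda>\<alpha>. (norm \<alpha>)\<^sup>2)"
    proof (rule real_bigo_norm_power2[OF MP])
      show "\<bar>case \<alpha> of (\<alpha>2, \<alpha>3) \<Rightarrow> P (\<alpha>2, \<alpha>3) - (1/2 * \<alpha>2 * c - 1/8 * \<alpha>3 * \<phi>210) / \<Delta>2\<bar>
          \<le> norm (PQ \<alpha> - lP \<alpha>)" for \<alpha>
        using norm_fst_le[where x = "fst (PQ \<alpha> - lP \<alpha>)" and y = "snd (PQ \<alpha> - lP \<alpha>)", unfolded prod.collapse] by (simp add: P_def lP_def case_prod_unfold)
    qed
    show "(\<lambda>(\<alpha>2, \<alpha>3). Q (\<alpha>2, \<alpha>3) - (\<alpha>3 * d - 1/2 * \<alpha>2 * \<phi>301) / \<Delta>2)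
        \<in> O[nhds 0](\<lambda>\<alpha>. (norm \<alpha>)\<^sup>2)"
    proof (rule real_bigo_norm_power2[OF MP])
      show "\<bar>case \<alpha> of (\<alpha>2, \<alpha>3) \<Rightarrow> Q (\<alpha>2, \<alpha>3) - (\<alpha>3 * d - 1/2 * \<alpha>2 * \<phi>301) / \<Delta>2\<bar>
          \<le> norm (PQ \<alpha> - lP \<alpha>)" for \<alpha>
        using norm_snd_le[where x = "fst (PQ \<alpha> - lP \<alpha>)" and y = "snd (PQ \<alpha> - lP \<alpha>)", unfolded prod.collapse] by (simp add: Q_def lP_def case_prod_unfold)
    qed
  qed (use equilibria orbitA orbitB torus bifA bifB curveA curveB in simp_all)
qed

end
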